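(* Let $\mathcal X$ be a semi-abelian category and $n\ge1$. Any Birkhoff reflector $F\colon\mathcal X\to\mathcal B$ commutes with $\mathrm{nil}_n$ up to isomorphism, under $F$. More precisely, there exists a natural isomorphism $\alpha\colon\mathrm{nil}_n^{\mathcal B}\circ F\Rightarrow F\circ\mathrm{nil}_n^{\mathcal X}$ such that $$\alpha_X\circ(\mathrm{nil}_n^{\mathcal B})^{\eta}_{F(X)}=F\bigl((\mathrm{nil}_n^{\mathcal X})^{\eta}_X\bigr)$$ for each object $X$ of $\mathcal X$, where $(\mathrm{nil}_n^{\mathcal X})^{\eta}_X\colon X\to\mathrm{nil}_n^{\mathcal X}(X)$ and $(\mathrm{nil}_n^{\mathcal B})^{\eta}_{F(X)}\colon F(X)\to\mathrm{nil}_n^{\mathcal B}(F(X))$ denote the components of the units of the respective $n$-nilpotent reflections.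
   Context: A semi-abelian category is a pointed, Barr-exact, Bourn-protomodular category with finite coproducts. A Birkhoff subcategory $\mathcal B$ of $\mathcal X$ is a full reflective subcategory closed under subobjects and regular quotient objects; it is again semi-abelian. A Birkhoff reflector is the left adjoint $F\colon\mathcal X\to\mathcal B$ to the inclusion. In a semi-abelian category $\mathcal Y$, the cosmash product $X_1\diamond\cdots\diamond X_m$ ($m\geq 2$) is the kernel of the morphism $X_1+\cdots+X_m\to\prod_{j=1}^m(X_1+\cdots+\widehat{X_j}+\cdots+X_m)$ whose $j$-th component is zero on $X_j$ and the coproduct inclusion on $X_k$, $k\ne j$. The $m$-ary commutator $[X,\dots,X]\leq X$ is the image of the composite $X\diamond\cdots\diamond X\to X+\cdots+X\to X$ ($m$ copies; the last arrow is the codiagonal); it is a normal subobject of $X$. For $n\ge1$, an object $X$ is $n$-nilpotent if its $(n+1)$-ary commutator $[X,\dots,X]$ vanishes. The full subcategory $\mathsf{Nil}_n(\mathcal Y)$ of $n$-nilpotent objects is a Birkhoff subcategory of $\mathcal Y$, with reflector $\mathrm{nil}_n^{\mathcal Y}(X)=X/[X,\dots,X]$ ($(n+1)$-ary commutator) and unit the canonical quotient $X\to\mathrm{nil}_n^{\mathcal Y}(X)$. All these notions are computed in $\mathcal X$ for $\mathrm{nil}_n^{\mathcal X}$ and in $\mathcal B$ for $\mathrm{nil}_n^{\mathcal B}$. *)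

theory Defs
  imports Main
begin

section \<open>Categories, functors, natural transformations\<close>

record ('o, 'm) cat =
  Obj :: "'o set"
  Arr :: "'m set"
  Dom :: "'m \<Rightarrow> 'o"
  Cod :: "'m \<Rightarrow> 'o"
  Ident :: "'o \<Rightarrow> 'm"
  Comp :: "'m \<Rightarrow> 'm \<Rightarrow> 'm"  (infixl "\<cdot>\<index>" 70)

definition hom :: "('o, 'm) cat \<Rightarrow> 'o \<Rightarrow> 'o \<Rightarrow> 'm set" where
  "hom C A B = {f \<in> Arr C. Dom C f = A \<and> Cod C f = B}"

locale category =
  fixes C :: "('o, 'm) cat" (structure)
  assumes Dom_Obj: "f \<in> Arr C \<Longrightarrow> Dom C f \<in> Obj C"
    and Cod_Obj: "f \<in> Arr C \<Longrightarrow> Cod C f \<in> Obj C"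
    and Ident_hom: "A \<in> Obj C \<Longrightarrow> Ident C A \<in> hom C A A"
    and Comp_hom: "f \<in> hom C A B \<Longrightarrow> g \<in> hom C B D \<Longrightarrow> g \<cdot> f \<in> hom C A D"
    and Comp_Ident: "f \<in> hom C A B \<Longrightarrow> f \<cdot> Ident C A = f"
    and Ident_Comp: "f \<in> hom C A B \<Longrightarrow> Ident C B \<cdot> f = f"
    and Comp_assoc: "f \<in> hom C A B \<Longrightarrow> g \<in> hom C B D \<Longrightarrow> h \<in> hom C D E
      \<Longrightarrow> (h \<cdot> g) \<cdot> f = h \<cdot> (g \<cdot> f)"

definition full_sub :: "('o, 'm) cat \<Rightarrow> 'o set \<Rightarrow> ('o, 'm) cat" where
  "full_sub C B = C\<lparr>Obj := B, Arr := {f \<in> Arr C. Dom C f \<in> B \<and> Cod C f \<in> B}\<rparr>"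

record ('o, 'm, 'p, 'q) ftor =
  on_obj :: "'o \<Rightarrow> 'p"
  on_arr :: "'m \<Rightarrow> 'q"

definition is_functor :: "('o, 'm) cat \<Rightarrow> ('p, 'q) cat \<Rightarrow> ('o, 'm, 'p, 'q) ftor \<Rightarrow> bool" where
  "is_functor C D F \<longleftrightarrow> category C \<and> category D \<and>
     (\<forall>A\<in>Obj C. on_obj F A \<in> Obj D) \<and>
     (\<forall>A B. \<forall>f\<in>hom C A B. on_arr F f \<in> hom D (on_obj F A) (on_obj F B)) \<and>
     (\<forall>A\<in>Obj C. on_arr F (Ident C A) = Ident D (on_obj F A)) \<and>
     (\<forall>f\<in>Arr C. \<forall>g\<in>Arr C. Cod C f = Dom C g \<longrightarrow>
        on_arr F (g \<cdot>\<^bsub>C\<^esub> f) = on_arr F g \<cdot>\<^bsub>D\<^esub> on_arr F f)"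

definition id_ftor :: "('o, 'm, 'o, 'm) ftor" where
  "id_ftor = \<lparr>on_obj = (\<lambda>A. A), on_arr = (\<lambda>f. f)\<rparr>"

definition comp_ftor ::
  "('p, 'q, 'r, 's) ftor \<Rightarrow> ('o, 'm, 'p, 'q) ftor \<Rightarrow> ('o, 'm, 'r, 's) ftor" (infixl "\<circ>\<^sub>F" 55) where
  "G \<circ>\<^sub>F F = \<lparr>on_obj = on_obj G \<circ> on_obj F, on_arr = on_arr G \<circ> on_arr F\<rparr>"

definition nat_transf :: "('o, 'm) cat \<Rightarrow> ('p, 'q) cat \<Rightarrow> ('o, 'm, 'p, 'q) ftor
    \<Rightarrow> ('o, 'm, 'p, 'q) ftor \<Rightarrow> ('o \<Rightarrow> 'q) \<Rightarrow> bool" where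
  "nat_transf C D F G \<alpha> \<longleftrightarrow> is_functor C D F \<and> is_functor C D G \<and>
     (\<forall>A\<in>Obj C. \<alpha> A \<in> hom D (on_obj F A) (on_obj G A)) \<and>
     (\<forall>A B. \<forall>f\<in>hom C A B. on_arr G f \<cdot>\<^bsub>D\<^esub> \<alpha> A = \<alpha> B \<cdot>\<^bsub>D\<^esub> on_arr F f)"

definition is_iso :: "('o, 'm) cat \<Rightarrow> 'm \<Rightarrow> bool" where
  "is_iso C f \<longleftrightarrow> f \<in> Arr C \<and>
     (\<exists>g\<in>hom C (Cod C f) (Dom C f). g \<cdot>\<^bsub>C\<^esub> f = Ident C (Dom C f) \<and> f \<cdot>\<^bsub>C\<^esub> g = Ident C (Cod C f))"

definition nat_iso :: "('o, 'm) cat \<Rightarrow> ('p, 'q) cat \<Rightarrow> ('o, 'm, 'p, 'q) ftor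
    \<Rightarrow> ('o, 'm, 'p, 'q) ftor \<Rightarrow> ('o \<Rightarrow> 'q) \<Rightarrow> bool" where
  "nat_iso C D F G \<alpha> \<longleftrightarrow> nat_transf C D F G \<alpha> \<and> (\<forall>A\<in>Obj C. is_iso D (\<alpha> A))"


section \<open>Limits and colimits\<close>

definition is_mono :: "('o, 'm) cat \<Rightarrow> 'm \<Rightarrow> bool" where
  "is_mono C m \<longleftrightarrow> m \<in> Arr C \<and>
     (\<forall>f\<in>Arr C. \<forall>g\<in>Arr C. Dom C f = Dom C g \<and> Cod C f = Dom C m \<and> Cod C g = Dom C m \<and>
        m \<cdot>\<^bsub>C\<^esub> f = m \<cdot>\<^bsub>C\<^esub> g \<longrightarrow> f = g)"

definition is_initial :: "('o, 'm) cat \<Rightarrow> 'o \<Rightarrow> bool" where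
  "is_initial C Z \<longleftrightarrow> Z \<in> Obj C \<and> (\<forall>A\<in>Obj C. \<exists>!f. f \<in> hom C Z A)"

definition is_terminal :: "('o, 'm) cat \<Rightarrow> 'o \<Rightarrow> bool" where
  "is_terminal C Z \<longleftrightarrow> Z \<in> Obj C \<and> (\<forall>A\<in>Obj C. \<exists>!f. f \<in> hom C A Z)"

definition is_product ::
  "('o, 'm) cat \<Rightarrow> 'i set \<Rightarrow> ('i \<Rightarrow> 'o) \<Rightarrow> 'o \<Rightarrow> ('i \<Rightarrow> 'm) \<Rightarrow> bool" where
  "is_product C I X P \<pi> \<longleftrightarrow> P \<in> Obj C \<and> (\<forall>i\<in>I. \<pi> i \<in> hom C P (X i)) \<and>
     (\<forall>A f. A \<in> Obj C \<and> (\<forall>i\<in>I. f i \<in> hom C A (X i)) \<longrightarrow>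
        (\<exists>!u. u \<in> hom C A P \<and> (\<forall>i\<in>I. \<pi> i \<cdot>\<^bsub>C\<^esub> u = f i)))"

definition is_coproduct ::
  "('o, 'm) cat \<Rightarrow> 'i set \<Rightarrow> ('i \<Rightarrow> 'o) \<Rightarrow> 'o \<Rightarrow> ('i \<Rightarrow> 'm) \<Rightarrow> bool" where
  "is_coproduct C I X S \<iota> \<longleftrightarrow> S \<in> Obj C \<and> (\<forall>i\<in>I. \<iota> i \<in> hom C (X i) S) \<and>
     (\<forall>A f. A \<in> Obj C \<and> (\<forall>i\<in>I. f i \<in> hom C (X i) A) \<longrightarrow>
        (\<exists>!u. u \<in> hom C S A \<and> (\<forall>i\<in>I. u \<cdot>\<^bsub>C\<^esub> \<iota> i = f i)))"

definition is_pullback :: "('o, 'm) cat \<Rightarrow> 'm \<Rightarrow> 'm \<Rightarrow> 'm \<Rightarrow> 'm \<Rightarrow> bool" where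
  "is_pullback C f g p q \<longleftrightarrow>
     f \<in> Arr C \<and> g \<in> Arr C \<and> p \<in> Arr C \<and> q \<in> Arr C \<and> Cod C f = Cod C g \<and>
     Dom C p = Dom C q \<and> Cod C p = Dom C f \<and> Cod C q = Dom C g \<and>
     f \<cdot>\<^bsub>C\<^esub> p = g \<cdot>\<^bsub>C\<^esub> q \<and>
     (\<forall>A a b. a \<in> hom C A (Dom C f) \<and> b \<in> hom C A (Dom C g) \<and> f \<cdot>\<^bsub>C\<^esub> a = g \<cdot>\<^bsub>C\<^esub> b \<longrightarrow>
        (\<exists>!u. u \<in> hom C A (Dom C p) \<and> p \<cdot>\<^bsub>C\<^esub> u = a \<and> q \<cdot>\<^bsub>C\<^esub> u = b))"

definition is_coequalizer :: "('o, 'm) cat \<Rightarrow> 'm \<Rightarrow> 'm \<Rightarrow> 'm \<Rightarrow> bool" where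
  "is_coequalizer C f g q \<longleftrightarrow>
     f \<in> Arr C \<and> g \<in> Arr C \<and> q \<in> Arr C \<and> Dom C f = Dom C g \<and> Cod C f = Cod C g \<and>
     Dom C q = Cod C f \<and> q \<cdot>\<^bsub>C\<^esub> f = q \<cdot>\<^bsub>C\<^esub> g \<and>
     (\<forall>A. \<forall>h\<in>hom C (Cod C f) A. h \<cdot>\<^bsub>C\<^esub> f = h \<cdot>\<^bsub>C\<^esub> g \<longrightarrow>
        (\<exists>!u. u \<in> hom C (Cod C q) A \<and> u \<cdot>\<^bsub>C\<^esub> q = h))"

definition is_regular_epi :: "('o, 'm) cat \<Rightarrow> 'm \<Rightarrow> bool" where
  "is_regular_epi C q \<longleftrightarrow> (\<exists>f g. is_coequalizer C f g q)"

definition is_zero_obj :: "('o, 'm) cat \<Rightarrow> 'o \<Rightarrow> bool" where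
  "is_zero_obj C Z \<longleftrightarrow> is_initial C Z \<and> is_terminal C Z"

definition is_zero_mor :: "('o, 'm) cat \<Rightarrow> 'm \<Rightarrow> bool" where
  "is_zero_mor C f \<longleftrightarrow> f \<in> Arr C \<and>
     (\<exists>Z a b. is_zero_obj C Z \<and> a \<in> hom C (Dom C f) Z \<and> b \<in> hom C Z (Cod C f) \<and> f = b \<cdot>\<^bsub>C\<^esub> a)"

definition is_kernel :: "('o, 'm) cat \<Rightarrow> 'm \<Rightarrow> 'm \<Rightarrow> bool" where
  "is_kernel C f k \<longleftrightarrow> f \<in> Arr C \<and> k \<in> Arr C \<and> Cod C k = Dom C f \<and> is_zero_mor C (f \<cdot>\<^bsub>C\<^esub> k) \<and>
     (\<forall>A. \<forall>h\<in>hom C A (Dom C f). is_zero_mor C (f \<cdot>\<^bsub>C\<^esub> h) \<longrightarrow>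
        (\<exists>!u. u \<in> hom C A (Dom C k) \<and> k \<cdot>\<^bsub>C\<^esub> u = h))"

definition is_cokernel :: "('o, 'm) cat \<Rightarrow> 'm \<Rightarrow> 'm \<Rightarrow> bool" where
  "is_cokernel C f q \<longleftrightarrow> f \<in> Arr C \<and> q \<in> Arr C \<and> Dom C q = Cod C f \<and> is_zero_mor C (q \<cdot>\<^bsub>C\<^esub> f) \<and>
     (\<forall>A. \<forall>h\<in>hom C (Cod C f) A. is_zero_mor C (h \<cdot>\<^bsub>C\<^esub> f) \<longrightarrow>
        (\<exists>!u. u \<in> hom C (Cod C q) A \<and> u \<cdot>\<^bsub>C\<^esub> q = h))"

definition is_image :: "('o, 'm) cat \<Rightarrow> 'm \<Rightarrow> 'm \<Rightarrow> bool" where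
  \<comment> \<open>the monomorphic part \<open>m\<close> of a (regular epi, mono)-factorisation of \<open>f\<close>\<close>
  "is_image C f m \<longleftrightarrow> is_mono C m \<and>
     (\<exists>e. is_regular_epi C e \<and> Cod C e = Dom C m \<and> f = m \<cdot>\<^bsub>C\<^esub> e)"


section \<open>Semi-abelian categories\<close>

definition pointed :: "('o, 'm) cat \<Rightarrow> bool" where
  "pointed C \<longleftrightarrow> (\<exists>Z. is_zero_obj C Z)"

definition finitely_complete :: "('o, 'm) cat \<Rightarrow> bool" where
  \<comment> \<open>finite limits, presented by a terminal object and pullbacks\<close>
  "finitely_complete C \<longleftrightarrow> (\<exists>Z. is_terminal C Z) \<and>
     (\<forall>f\<in>Arr C. \<forall>g\<in>Arr C. Cod C f = Cod C g \<longrightarrow> (\<exists>p q. is_pullback C f g p q))"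

definition has_finite_coproducts :: "('o, 'm) cat \<Rightarrow> bool" where
  "has_finite_coproducts C \<longleftrightarrow>
     (\<forall>(I::nat set) X. finite I \<and> (\<forall>i\<in>I. X i \<in> Obj C) \<longrightarrow> (\<exists>S \<iota>. is_coproduct C I X S \<iota>))"

definition regular_category :: "('o, 'm) cat \<Rightarrow> bool" where
  "regular_category C \<longleftrightarrow> category C \<and> finitely_complete C \<and>
     (\<forall>f p q. is_pullback C f f p q \<longrightarrow> (\<exists>c. is_coequalizer C p q c)) \<and>
     (\<forall>f g p q. is_pullback C f g p q \<and> is_regular_epi C g \<longrightarrow> is_regular_epi C p)"

definition internal_equivalence :: "('o, 'm) cat \<Rightarrow> 'm \<Rightarrow> 'm \<Rightarrow> bool" where
  \<comment> \<open>jointly monic, reflexive, symmetric and transitive pair of parallel arrows\<close>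
  "internal_equivalence C r s \<longleftrightarrow>
     r \<in> Arr C \<and> s \<in> Arr C \<and> Dom C r = Dom C s \<and> Cod C r = Cod C s \<and>
     (\<forall>A. \<forall>f\<in>hom C A (Dom C r). \<forall>g\<in>hom C A (Dom C r).
        r \<cdot>\<^bsub>C\<^esub> f = r \<cdot>\<^bsub>C\<^esub> g \<and> s \<cdot>\<^bsub>C\<^esub> f = s \<cdot>\<^bsub>C\<^esub> g \<longrightarrow> f = g) \<and>
     (\<exists>d\<in>hom C (Cod C r) (Dom C r).
        r \<cdot>\<^bsub>C\<^esub> d = Ident C (Cod C r) \<and> s \<cdot>\<^bsub>C\<^esub> d = Ident C (Cod C r)) \<and>
     (\<exists>t\<in>hom C (Dom C r) (Dom C r). r \<cdot>\<^bsub>C\<^esub> t = s \<and> s \<cdot>\<^bsub>C\<^esub> t = r) \<and>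
     (\<forall>p q. is_pullback C s r p q \<longrightarrow>
        (\<exists>t\<in>hom C (Dom C p) (Dom C r). r \<cdot>\<^bsub>C\<^esub> t = r \<cdot>\<^bsub>C\<^esub> p \<and> s \<cdot>\<^bsub>C\<^esub> t = s \<cdot>\<^bsub>C\<^esub> q))"

definition barr_exact :: "('o, 'm) cat \<Rightarrow> bool" where
  "barr_exact C \<longleftrightarrow> regular_category C \<and>
     (\<forall>r s. internal_equivalence C r s \<longrightarrow> (\<exists>f. is_pullback C f f r s))"

definition is_point :: "('o, 'm) cat \<Rightarrow> 'm \<Rightarrow> 'm \<Rightarrow> bool" where
  \<comment> \<open>an object of the fibre over \<open>Cod C p\<close> of the fibration of points\<close>
  "is_point C p s \<longleftrightarrow> p \<in> Arr C \<and> s \<in> hom C (Cod C p) (Dom C p) \<and> p \<cdot>\<^bsub>C\<^esub> s = Ident C (Cod C p)"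

definition is_point_mor :: "('o, 'm) cat \<Rightarrow> 'm \<Rightarrow> 'm \<Rightarrow> 'm \<Rightarrow> 'm \<Rightarrow> 'm \<Rightarrow> bool" where
  "is_point_mor C p s p' s' h \<longleftrightarrow> is_point C p s \<and> is_point C p' s' \<and> Cod C p = Cod C p' \<and>
     h \<in> hom C (Dom C p) (Dom C p') \<and> p' \<cdot>\<^bsub>C\<^esub> h = p \<and> h \<cdot>\<^bsub>C\<^esub> s = s'"

definition protomodular :: "('o, 'm) cat \<Rightarrow> bool" where
  \<comment> \<open>The change-of-base functors \<open>v\<^sup>*\<close> of the fibration of points reflect isomorphisms. Here
    \<open>(a, b)\<close> and \<open>(a', b')\<close> are pullbacks of \<open>p\<close> and \<open>p'\<close> along \<open>v\<close>, and \<open>u\<close> is \<open>v\<^sup>* h\<close>.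
    The inverse of an invertible \<open>h\<close> or \<open>u\<close> is automatically a morphism of points.\<close>
  "protomodular C \<longleftrightarrow>
     (\<forall>v p s p' s' h a b a' b' u.
        v \<in> Arr C \<and> is_point_mor C p s p' s' h \<and>
        is_pullback C v p a b \<and> is_pullback C v p' a' b' \<and>
        u \<in> hom C (Dom C a) (Dom C a') \<and> a' \<cdot>\<^bsub>C\<^esub> u = a \<and> b' \<cdot>\<^bsub>C\<^esub> u = h \<cdot>\<^bsub>C\<^esub> b \<and>
        is_iso C u \<longrightarrow> is_iso C h)"

definition semi_abelian :: "('o, 'm) cat \<Rightarrow> bool" where
  "semi_abelian C \<longleftrightarrow>
     category C \<and> pointed C \<and> barr_exact C \<and> protomodular C \<and> has_finite_coproducts C"


section \<open>Birkhoff subcategories\<close>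

definition is_reflector :: "('o, 'm) cat \<Rightarrow> 'o set \<Rightarrow> ('o, 'm, 'o, 'm) ftor \<Rightarrow> bool" where
  \<comment> \<open>\<open>F\<close> is left adjoint to the inclusion of the full subcategory on \<open>B\<close>, via the unit \<open>\<eta>\<close>\<close>
  "is_reflector C B F \<longleftrightarrow> B \<subseteq> Obj C \<and> is_functor C (full_sub C B) F \<and>
     (\<exists>\<eta>. nat_transf C C id_ftor F \<eta> \<and>
        (\<forall>A\<in>Obj C. \<forall>D\<in>B. \<forall>f\<in>hom C A D. \<exists>!g. g \<in> hom C (on_obj F A) D \<and> g \<cdot>\<^bsub>C\<^esub> \<eta> A = f))"

definition is_birkhoff :: "('o, 'm) cat \<Rightarrow> 'o set \<Rightarrow> bool" where
  "is_birkhoff C B \<longleftrightarrow> B \<subseteq> Obj C \<and> (\<exists>F. is_reflector C B F) \<and>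
     (\<forall>m. is_mono C m \<and> Cod C m \<in> B \<longrightarrow> Dom C m \<in> B) \<and>
     (\<forall>q. is_regular_epi C q \<and> Dom C q \<in> B \<longrightarrow> Cod C q \<in> B)"


section \<open>Higher commutators and nilpotency\<close>

definition is_cosmash ::
  "('o, 'm) cat \<Rightarrow> nat \<Rightarrow> (nat \<Rightarrow> 'o) \<Rightarrow> 'o \<Rightarrow> (nat \<Rightarrow> 'm) \<Rightarrow> 'm \<Rightarrow> bool" where
  \<comment> \<open>\<open>S\<close>, \<open>\<iota>\<close> is the coproduct of the \<open>X i\<close>, \<open>i < m\<close>, and \<open>k\<close> is the inclusion of the cosmash
    product into it; \<open>T j\<close>, \<open>\<kappa> j\<close> is the coproduct with the \<open>j\<close>-th summand omitted.\<close>
  "is_cosmash C m X S \<iota> k \<longleftrightarrow> is_coproduct C {..<m} X S \<iota> \<and>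
     (\<exists>T \<kappa> P \<pi> r.
        (\<forall>j<m. is_coproduct C ({..<m} - {j}) X (T j) (\<kappa> j)) \<and>
        is_product C {..<m} T P \<pi> \<and>
        r \<in> hom C S P \<and>
        (\<forall>j<m. \<forall>i<m. if i = j then is_zero_mor C (\<pi> j \<cdot>\<^bsub>C\<^esub> r \<cdot>\<^bsub>C\<^esub> \<iota> i)
                      else \<pi> j \<cdot>\<^bsub>C\<^esub> r \<cdot>\<^bsub>C\<^esub> \<iota> i = \<kappa> j i) \<and>
        is_kernel C r k)"

definition is_commutator :: "('o, 'm) cat \<Rightarrow> nat \<Rightarrow> 'o \<Rightarrow> 'm \<Rightarrow> bool" where
  \<comment> \<open>the monomorphism \<open>c\<close> represents the \<open>m\<close>-ary commutator \<open>[X, \<dots>, X] \<le> X\<close>;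
    \<open>d\<close> is the codiagonal\<close>
  "is_commutator C m X c \<longleftrightarrow>
     (\<exists>S \<iota> k d. is_cosmash C m (\<lambda>_. X) S \<iota> k \<and>
        d \<in> hom C S X \<and> (\<forall>i<m. d \<cdot>\<^bsub>C\<^esub> \<iota> i = Ident C X) \<and>
        is_image C (d \<cdot>\<^bsub>C\<^esub> k) c)"

definition nilpotent_objects :: "('o, 'm) cat \<Rightarrow> nat \<Rightarrow> 'o set" where
  "nilpotent_objects C n = {X \<in> Obj C. \<exists>c. is_commutator C (n + 1) X c \<and> is_zero_obj C (Dom C c)}"

definition is_nil_reflection ::
  "('o, 'm) cat \<Rightarrow> nat \<Rightarrow> ('o, 'm, 'o, 'm) ftor \<Rightarrow> ('o \<Rightarrow> 'm) \<Rightarrow> bool" where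
  \<comment> \<open>\<open>N\<close> with unit \<open>\<nu>\<close> is a choice of the \<open>n\<close>-nilpotent reflection, \<open>\<nu> X\<close> being a canonical quotient
    \<open>X \<rightarrow> X/[X, \<dots>, X]\<close>. This determines \<open>(N, \<nu>)\<close> up to unique isomorphism; when \<open>C\<close> is
    semi-abelian, the universal property of \<open>\<nu> X\<close> among \<open>n\<close>-nilpotent objects is a consequence.\<close>
  "is_nil_reflection C n N \<nu> \<longleftrightarrow>
     is_functor C (full_sub C (nilpotent_objects C n)) N \<and> nat_transf C C id_ftor N \<nu> \<and>
     (\<forall>X\<in>Obj C. \<exists>c. is_commutator C (n + 1) X c \<and> is_cokernel C c (\<nu> X))"

end

theory Submission
  imports Defs
begin

text \<open>The functor \<open>F\<close> being left adjoint, \<open>F (\<nu>\<^sub>X A)\<close> is the cokernel in \<open>B\<close> of the commutator inclusion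
  of \<open>F A\<close> as soon as a morphism from \<open>F A\<close> into an object of \<open>B\<close> kills the commutator of \<open>F A\<close> computed
  in \<open>B\<close> exactly when its composite with the unit at \<open>A\<close> kills the commutator of \<open>A\<close>. This follows once
  the comparison between the cosmash products of copies of \<open>A\<close> and of \<open>F A\<close> is a regular epimorphism.
  The comparison of coproducts \<open>S \<rightarrow> S'\<close> is a regular epimorphism since \<open>B\<close> is closed under subobjects, and
  a cosmash product is the joint kernel of the commuting idempotents of \<open>S\<close> that kill one summand. A regular
  epimorphism compatible with idempotents on both sides restricts to a regular epimorphism between
  their kernels, by protomodularity, and this can be iterated over the idempotents.\<close>

text \<open>The obstacle is that \<open>F\<close> preserves colimits, whereas a cosmash product is a
  kernel, and left adjoints need not preserve kernels. So the cosmash products built from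
  \<open>A\<close> and from \<open>F A\<close> are not expected to correspond under
  \<open>F\<close>. A regular epimorphism between them is enough: a cokernel depends only on which
  arrows kill the given one, and an arrow is zero as soon as its composite with a regular
  epimorphism is zero. The second obstacle is that regular epimorphisms do not restrict to kernels
  of arbitrary arrows, in particular not to the kernel of the arrow into a product that defines the
  cosmash product. Kernels of idempotents are better behaved because an idempotent splits, and a
  split epimorphism together with its section is what protomodularity speaks about. Regular
  epimorphisms of \<open>B\<close> are never converted into regular epimorphisms of the ambient
  category: each image is cancelled in the category where it was formed, and only the vanishing of
  arrows is carried across.\<close>

section \<open>Monomorphisms, pullbacks and regular epimorphisms\<close>

context category
begin

lemma Comp_Arr [simp]:
  assumes "f \<in> Arr C" "g \<in> Arr C" "Cod C f = Dom C g"
  shows "g \<cdot> f \<in> Arr C" "Dom C (g \<cdot> f) = Dom C f" "Cod C (g \<cdot> f) = Cod C g"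
  using Comp_hom[of f "Dom C f" "Cod C f" g "Cod C g"] assms by (auto simp: hom_def)

lemma assoc:
  assumes "f \<in> Arr C" "g \<in> Arr C" "h \<in> Arr C" "Cod C f = Dom C g" "Cod C g = Dom C h"
  shows "(h \<cdot> g) \<cdot> f = h \<cdot> (g \<cdot> f)"
  using Comp_assoc[of f "Dom C f" "Cod C f" g "Cod C g" h "Cod C h"] assms by (auto simp: hom_def)

lemma Ident_Arr [simp]:
  assumes "A \<in> Obj C"
  shows "Ident C A \<in> Arr C" "Dom C (Ident C A) = A" "Cod C (Ident C A) = A"
  using Ident_hom[OF assms] by (auto simp: hom_def)

lemma Ident_neutral [simp]:
  assumes "f \<in> Arr C"
  shows "Dom C f = A \<Longrightarrow> f \<cdot> Ident C A = f" "Cod C f = A \<Longrightarrow> Ident C A \<cdot> f = f"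
  using Comp_Ident[of f] Ident_Comp[of f] assms by (auto simp: hom_def)

declare Dom_Obj [simp] Cod_Obj [simp]

lemma monoD:
  assumes "is_mono C m" "f \<in> Arr C" "g \<in> Arr C" "Dom C f = Dom C g"
    "Cod C f = Dom C m" "Cod C g = Dom C m" "m \<cdot> f = m \<cdot> g"
  shows "f = g"
  using assms by (auto simp: is_mono_def)

lemma mono_Comp:
  assumes "is_mono C m" "is_mono C k" "Cod C k = Dom C m"
  shows "is_mono C (m \<cdot> k)"
proof -
  have A: "m \<in> Arr C" "k \<in> Arr C" using assms by (auto simp: is_mono_def)
  show ?thesis
    unfolding is_mono_def
  proof (intro conjI ballI impI)
    fix f g assume "f \<in> Arr C" "g \<in> Arr C"
      "Dom C f = Dom C g \<and> Cod C f = Dom C (m \<cdot> k) \<and> Cod C g = Dom C (m \<cdot> k)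
        \<and> m \<cdot> k \<cdot> f = m \<cdot> k \<cdot> g"
    then have h: "f \<in> Arr C" "g \<in> Arr C" "Dom C f = Dom C g" "Cod C f = Dom C k" "Cod C g = Dom C k"
      and eq: "m \<cdot> k \<cdot> f = m \<cdot> k \<cdot> g"
      using A assms(3) by simp_all
    have "m \<cdot> (k \<cdot> f) = m \<cdot> (k \<cdot> g)"
      using eq A h assms(3) assoc[of f k m] assoc[of g k m] by metis
    then have "k \<cdot> f = k \<cdot> g"
      by (rule monoD[OF assms(1), rotated -1]) (use A h assms(3) in simp_all)
    then show "f = g"
      by (rule monoD[OF assms(2), rotated -1]) (use A h in simp_all)
  qed (use A assms in auto)
qed

lemma mono_split_iso:
  assumes "is_mono C m" "u \<in> hom C (Cod C m) (Dom C m)" "m \<cdot> u = Ident C (Cod C m)"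
  shows "is_iso C m"
proof -
  have A: "m \<in> Arr C" "u \<in> Arr C" "Dom C u = Cod C m" "Cod C u = Dom C m"
    using assms by (auto simp: is_mono_def hom_def)
  have "m \<cdot> (u \<cdot> m) = m \<cdot> Ident C (Dom C m)"
    using A assms(3) by (simp add: assoc[symmetric])
  then have "u \<cdot> m = Ident C (Dom C m)"
    by (rule monoD[OF assms(1), rotated -1]) (use A in auto)
  then show ?thesis using A assms by (auto simp: is_iso_def)
qed

lemma pullbackD:
  assumes "is_pullback C f g p q"
  shows "f \<in> Arr C" "g \<in> Arr C" "p \<in> Arr C" "q \<in> Arr C" "Cod C g = Cod C f"
    "Dom C q = Dom C p" "Cod C p = Dom C f" "Cod C q = Dom C g" "f \<cdot> p = g \<cdot> q"
  using assms by (auto simp: is_pullback_def)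

lemma pullback_lift:
  assumes "is_pullback C f g p q" "a \<in> Arr C" "b \<in> Arr C" "Dom C a = Dom C b"
    "Cod C a = Dom C f" "Cod C b = Dom C g" "f \<cdot> a = g \<cdot> b"
  obtains u where "u \<in> Arr C" "Dom C u = Dom C b" "Cod C u = Dom C p" "p \<cdot> u = a" "q \<cdot> u = b"
proof -
  have "a \<in> hom C (Dom C b) (Dom C f) \<and> b \<in> hom C (Dom C b) (Dom C g) \<and> f \<cdot> a = g \<cdot> b"
    using assms by (auto simp: hom_def)
  then have "\<exists>!u. u \<in> hom C (Dom C b) (Dom C p) \<and> p \<cdot> u = a \<and> q \<cdot> u = b"
    using assms(1) unfolding is_pullback_def by blast
  then show ?thesis using that by (auto simp: hom_def)
qed

lemma pullback_unique:
  assumes pb: "is_pullback C f g p q" and u: "u \<in> Arr C" "v \<in> Arr C" "Dom C u = Dom C v"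
    "Cod C u = Dom C p" "Cod C v = Dom C p" "p \<cdot> u = p \<cdot> v" "q \<cdot> u = q \<cdot> v"
  shows "u = v"
proof -
  note P = pullbackD[OF pb]
  have "f \<cdot> (p \<cdot> u) = g \<cdot> (q \<cdot> u)"
    using P u by (simp add: assoc[symmetric])
  then have "p \<cdot> u \<in> hom C (Dom C u) (Dom C f) \<and> q \<cdot> u \<in> hom C (Dom C u) (Dom C g)
      \<and> f \<cdot> (p \<cdot> u) = g \<cdot> (q \<cdot> u)"
    using P u by (auto simp: hom_def)
  then have "\<exists>!w. w \<in> hom C (Dom C u) (Dom C p) \<and> p \<cdot> w = p \<cdot> u \<and> q \<cdot> w = q \<cdot> u"
    using pb unfolding is_pullback_def by blast
  moreover have "u \<in> hom C (Dom C u) (Dom C p)" "v \<in> hom C (Dom C u) (Dom C p)"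
    using u by (auto simp: hom_def)
  ultimately show ?thesis using u by metis
qed

lemma regular_epi_Arr: "is_regular_epi C q \<Longrightarrow> q \<in> Arr C"
  by (auto simp: is_regular_epi_def is_coequalizer_def)

lemma coequalizer_unique:
  assumes c: "is_coequalizer C f g q" and x: "x \<in> Arr C" "y \<in> Arr C"
    "Dom C x = Cod C q" "Dom C y = Cod C q" "x \<cdot> q = y \<cdot> q"
  shows "x = y"
proof -
  have A: "f \<in> Arr C" "g \<in> Arr C" "q \<in> Arr C" "Dom C f = Dom C g" "Cod C f = Cod C g"
    "Dom C q = Cod C f" "q \<cdot> f = q \<cdot> g"
    using c by (auto simp: is_coequalizer_def)
  have cod: "Cod C x = Cod C y"
    using Comp_Arr(3)[of q x] Comp_Arr(3)[of q y] A(3) x by metis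
  have "x \<cdot> q \<in> hom C (Cod C f) (Cod C x)" "x \<cdot> q \<cdot> f = x \<cdot> q \<cdot> g"
    using A x(1-4) by (auto simp: hom_def assoc)
  then have "\<exists>!u. u \<in> hom C (Cod C q) (Cod C x) \<and> u \<cdot> q = x \<cdot> q"
    using c unfolding is_coequalizer_def by blast
  moreover have "x \<in> hom C (Cod C q) (Cod C x)" "y \<in> hom C (Cod C q) (Cod C x)"
    using x cod by (auto simp: hom_def)
  ultimately show ?thesis using x(5) by metis
qed

lemma regular_epi_cancel:
  assumes "is_regular_epi C q" "x \<in> Arr C" "y \<in> Arr C"
    "Dom C x = Cod C q" "Dom C y = Cod C q" "x \<cdot> q = y \<cdot> q"
  shows "x = y"
  using assms coequalizer_unique unfolding is_regular_epi_def by blast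

text \<open>Since \<open>m\<close> is monic, \<open>h\<close> identifies the pair that
  \<open>q\<close> coequalizes, so it descends along \<open>q\<close> to a right inverse of
  \<open>m\<close>; a monomorphism with a right inverse is invertible.\<close>

lemma regular_epi_extremal:
  assumes "is_regular_epi C q" "is_mono C m" "h \<in> Arr C" "Cod C h = Dom C m" "m \<cdot> h = q"
  shows "is_iso C m"
proof -
  obtain f g where c: "is_coequalizer C f g q" using assms(1) by (auto simp: is_regular_epi_def)
  then have A: "f \<in> Arr C" "g \<in> Arr C" "q \<in> Arr C" "Dom C f = Dom C g" "Cod C f = Cod C g"
    "Dom C q = Cod C f" "q \<cdot> f = q \<cdot> g"
    by (auto simp: is_coequalizer_def)
  have M: "m \<in> Arr C" using assms by (auto simp: is_mono_def)
  have D: "Dom C h = Dom C q" "Cod C m = Cod C q"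
    using Comp_Arr[of h m] assms M by auto
  have "m \<cdot> (h \<cdot> f) = m \<cdot> (h \<cdot> g)"
    using A M D assms by (simp add: assoc[symmetric])
  then have "h \<cdot> f = h \<cdot> g"
    by (rule monoD[OF assms(2), rotated -1]) (use A M D assms(3,4) in auto)
  moreover have "h \<in> hom C (Cod C f) (Dom C m)" using A D assms by (auto simp: hom_def)
  ultimately obtain u where u: "u \<in> hom C (Cod C q) (Dom C m)" "u \<cdot> q = h"
    using c unfolding is_coequalizer_def by blast
  have "m \<cdot> u = Ident C (Cod C q)"
    by (rule coequalizer_unique[OF c]) (use u A(1-6) M D assms(3-5) in \<open>auto simp: hom_def assoc\<close>)
  then show ?thesis using u D by (intro mono_split_iso[OF assms(2)]) auto
qed

subsection \<open>Zero morphisms\<close>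

lemma zero_mor_Arr: "is_zero_mor C f \<Longrightarrow> f \<in> Arr C"
  by (simp add: is_zero_mor_def)

lemma zero_mor_Comp_left:
  assumes "is_zero_mor C f" "g \<in> Arr C" "Cod C f = Dom C g"
  shows "is_zero_mor C (g \<cdot> f)"
proof -
  obtain Z a b where Z: "is_zero_obj C Z" "a \<in> hom C (Dom C f) Z" "b \<in> hom C Z (Cod C f)" "f \<in> Arr C"
    and eq: "f = b \<cdot> a"
    using assms(1) unfolding is_zero_mor_def by blast
  have "g \<cdot> b \<in> hom C Z (Cod C (g \<cdot> f))" "a \<in> hom C (Dom C (g \<cdot> f)) Z" "g \<cdot> f \<in> Arr C"
    using Z assms(2,3) by (auto simp: hom_def)
  moreover have "g \<cdot> b \<cdot> a = g \<cdot> (b \<cdot> a)"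
    by (rule assoc) (use Z assms in \<open>auto simp: hom_def\<close>)
  then have "g \<cdot> f = g \<cdot> b \<cdot> a" using eq by simp
  ultimately show ?thesis using Z(1) unfolding is_zero_mor_def by blast
qed

lemma zero_mor_Comp_right:
  assumes "is_zero_mor C f" "g \<in> Arr C" "Cod C g = Dom C f"
  shows "is_zero_mor C (f \<cdot> g)"
proof -
  obtain Z a b where Z: "is_zero_obj C Z" "a \<in> hom C (Dom C f) Z" "b \<in> hom C Z (Cod C f)" "f \<in> Arr C"
    and eq: "f = b \<cdot> a"
    using assms(1) unfolding is_zero_mor_def by blast
  have "b \<in> hom C Z (Cod C (f \<cdot> g))" "a \<cdot> g \<in> hom C (Dom C (f \<cdot> g)) Z" "f \<cdot> g \<in> Arr C"
    using Z assms(2,3) by (auto simp: hom_def)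
  moreover have "b \<cdot> a \<cdot> g = b \<cdot> (a \<cdot> g)"
    by (rule assoc) (use Z assms in \<open>auto simp: hom_def\<close>)
  then have "f \<cdot> g = b \<cdot> (a \<cdot> g)" using eq by simp
  ultimately show ?thesis using Z(1) unfolding is_zero_mor_def by blast
qed

text \<open>The two arrows may factor through different zero objects; the arrow \<open>t\<close>
  between these makes the factorizations agree.\<close>

lemma zero_mor_unique:
  assumes "is_zero_mor C f" "is_zero_mor C g" "Dom C f = Dom C g" "Cod C f = Cod C g"
  shows "f = g"
proof -
  obtain Z a b where Z: "is_zero_obj C Z" "a \<in> hom C (Dom C f) Z" "b \<in> hom C Z (Cod C f)"
    and f: "f = b \<cdot> a"
    using assms(1) unfolding is_zero_mor_def by blast
  obtain W c d where W: "is_zero_obj C W" "c \<in> hom C (Dom C f) W" "d \<in> hom C W (Cod C f)"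
    and g: "g = d \<cdot> c"
    using assms(2-4) unfolding is_zero_mor_def by metis
  have "Z \<in> Obj C" "W \<in> Obj C" using Z W by (auto simp: is_zero_obj_def is_initial_def)
  then obtain t where t: "t \<in> hom C Z W" using W(1) by (auto simp: is_zero_obj_def is_terminal_def)
  have O: "Dom C f \<in> Obj C" "Cod C f \<in> Obj C" using assms(1) zero_mor_Arr by auto
  have "t \<cdot> a \<in> hom C (Dom C f) W" "d \<cdot> t \<in> hom C Z (Cod C f)"
    using t Z W by (auto simp: hom_def)
  then have "t \<cdot> a = c" "d \<cdot> t = b"
    using W Z O unfolding is_zero_obj_def is_terminal_def is_initial_def by blast+
  moreover have "d \<cdot> t \<cdot> a = d \<cdot> (t \<cdot> a)"
    by (rule assoc) (use t Z W in \<open>auto simp: hom_def\<close>)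
  ultimately show ?thesis using f g by simp
qed

end

locale pointed_category = category +
  assumes pointed: "pointed C"
begin

lemma zero_mor_exists:
  assumes "A \<in> Obj C" "B \<in> Obj C"
  obtains z where "is_zero_mor C z" "z \<in> Arr C" "Dom C z = A" "Cod C z = B"
proof -
  obtain Z where Z: "is_zero_obj C Z" using pointed by (auto simp: pointed_def)
  then obtain a b where ab: "a \<in> hom C A Z" "b \<in> hom C Z B"
    using assms unfolding is_zero_obj_def is_terminal_def is_initial_def by blast
  then have "b \<cdot> a \<in> hom C A B" "a \<in> hom C (Dom C (b \<cdot> a)) Z" "b \<in> hom C Z (Cod C (b \<cdot> a))"
    by (auto simp: hom_def)
  with Z have "is_zero_mor C (b \<cdot> a)" "b \<cdot> a \<in> hom C A B"
    unfolding is_zero_mor_def by (auto simp: hom_def)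
  then show ?thesis by (intro that) (auto simp: hom_def)
qed

lemma zero_mor_cancel_mono:
  assumes "is_mono C m" "f \<in> Arr C" "Cod C f = Dom C m" "is_zero_mor C (m \<cdot> f)"
  shows "is_zero_mor C f"
proof -
  have m: "m \<in> Arr C" using assms by (auto simp: is_mono_def)
  obtain z where z: "is_zero_mor C z" "z \<in> Arr C" "Dom C z = Dom C f" "Cod C z = Cod C f"
    using zero_mor_exists[OF Dom_Obj[OF assms(2)] Cod_Obj[OF assms(2)]] by blast
  have "m \<cdot> f = m \<cdot> z"
    by (rule zero_mor_unique) (use z assms m in \<open>auto intro!: zero_mor_Comp_left\<close>)
  then have "f = z" by (rule monoD[OF assms(1), rotated -1]) (use z assms m in auto)
  then show ?thesis using z by simp
qed

text \<open>This makes a regular epimorphism between cosmash products as good as an isomorphism for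
  testing which arrows vanish.\<close>

lemma zero_mor_cancel_regular_epi:
  assumes "is_regular_epi C q" "f \<in> Arr C" "Cod C q = Dom C f" "is_zero_mor C (f \<cdot> q)"
  shows "is_zero_mor C f"
proof -
  note q = regular_epi_Arr[OF assms(1)]
  obtain z where z: "is_zero_mor C z" "z \<in> Arr C" "Dom C z = Dom C f" "Cod C z = Cod C f"
    using zero_mor_exists[OF Dom_Obj[OF assms(2)] Cod_Obj[OF assms(2)]] by blast
  have "f \<cdot> q = z \<cdot> q"
    by (rule zero_mor_unique) (use z assms q in \<open>auto intro!: zero_mor_Comp_right\<close>)
  then have "f = z" by (rule regular_epi_cancel[OF assms(1), rotated -1]) (use z assms in auto)
  then show ?thesis using z by simp
qed

lemma kernelD:
  assumes "is_kernel C f k"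
  shows "f \<in> Arr C" "k \<in> Arr C" "Cod C k = Dom C f" "is_zero_mor C (f \<cdot> k)" "is_mono C k"
proof -
  show A: "f \<in> Arr C" "k \<in> Arr C" "Cod C k = Dom C f" "is_zero_mor C (f \<cdot> k)"
    using assms by (auto simp: is_kernel_def)
  show "is_mono C k"
    unfolding is_mono_def
  proof (intro conjI ballI impI)
    fix x y assume xy: "x \<in> Arr C" "y \<in> Arr C" "Dom C x = Dom C y \<and> Cod C x = Dom C k
      \<and> Cod C y = Dom C k \<and> k \<cdot> x = k \<cdot> y"
    have "is_zero_mor C (f \<cdot> (k \<cdot> x))"
      using A xy zero_mor_Comp_right[of "f \<cdot> k" x] by (simp add: assoc)
    moreover have "k \<cdot> x \<in> hom C (Dom C x) (Dom C f)" using A xy by (auto simp: hom_def)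
    ultimately have "\<exists>!u. u \<in> hom C (Dom C x) (Dom C k) \<and> k \<cdot> u = k \<cdot> x"
      using assms unfolding is_kernel_def by blast
    moreover have "x \<in> hom C (Dom C x) (Dom C k)" "y \<in> hom C (Dom C x) (Dom C k)"
      using xy by (auto simp: hom_def)
    ultimately show "x = y" using xy by metis
  qed (rule A)
qed

lemma kernel_lift:
  assumes "is_kernel C f k" "h \<in> Arr C" "Cod C h = Dom C f" "is_zero_mor C (f \<cdot> h)"
  obtains u where "u \<in> Arr C" "Dom C u = Dom C h" "Cod C u = Dom C k" "k \<cdot> u = h"
proof -
  have "h \<in> hom C (Dom C h) (Dom C f)" using assms by (auto simp: hom_def)
  then show ?thesis using assms(1,4) that unfolding is_kernel_def hom_def by blast
qed

subsection \<open>Joint kernels and cosmash products\<close>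

text \<open>Monicity stands in for uniqueness of the lift. The common domain of the
  \<open>e j\<close> is read off as \<open>Cod C k\<close>, so the notion makes sense for empty
  \<open>J\<close>, where \<open>k\<close> is an isomorphism; the induction over the idempotents
  starts there.\<close>

definition joint_kernel :: "'i set \<Rightarrow> ('i \<Rightarrow> 'b) \<Rightarrow> 'b \<Rightarrow> bool" where
  "joint_kernel J e k \<longleftrightarrow> is_mono C k \<and> (\<forall>j\<in>J. is_zero_mor C (e j \<cdot> k)) \<and>
     (\<forall>x\<in>Arr C. Cod C x = Cod C k \<and> (\<forall>j\<in>J. is_zero_mor C (e j \<cdot> x)) \<longrightarrow>
        (\<exists>u\<in>hom C (Dom C x) (Dom C k). k \<cdot> u = x))"

lemma joint_kernel_lift:
  assumes "joint_kernel J e k" "x \<in> Arr C" "Cod C x = Cod C k" "\<And>j. j \<in> J \<Longrightarrow> is_zero_mor C (e j \<cdot> x)"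
  obtains u where "u \<in> Arr C" "Dom C u = Dom C x" "Cod C u = Dom C k" "k \<cdot> u = x"
  using assms unfolding joint_kernel_def hom_def by blast

lemma coproduct_eqI:
  assumes cp: "is_coproduct C I Y S \<iota>" and u: "u \<in> hom C S A" "v \<in> hom C S A"
    and eq: "\<And>i. i \<in> I \<Longrightarrow> u \<cdot> \<iota> i = v \<cdot> \<iota> i"
  shows "u = v"
proof -
  have "A \<in> Obj C" using u by (auto simp: hom_def)
  moreover have "\<forall>i\<in>I. u \<cdot> \<iota> i \<in> hom C (Y i) A"
    using cp u by (auto simp: is_coproduct_def hom_def)
  ultimately have "\<exists>!w. w \<in> hom C S A \<and> (\<forall>i\<in>I. w \<cdot> \<iota> i = u \<cdot> \<iota> i)"
    using cp[unfolded is_coproduct_def, THEN conjunct2, THEN conjunct2, rule_format, of A "\<lambda>i. u \<cdot> \<iota> i"]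
    by simp
  moreover have "\<forall>i\<in>I. v \<cdot> \<iota> i = u \<cdot> \<iota> i" using eq by simp
  ultimately show ?thesis using u by blast
qed

lemma coproduct_lift:
  assumes "is_coproduct C I Y S \<iota>" "A \<in> Obj C" "\<And>i. i \<in> I \<Longrightarrow> f i \<in> hom C (Y i) A"
  obtains u where "u \<in> hom C S A" "\<And>i. i \<in> I \<Longrightarrow> u \<cdot> \<iota> i = f i"
proof -
  have "\<exists>!u. u \<in> hom C S A \<and> (\<forall>i\<in>I. u \<cdot> \<iota> i = f i)"
    using assms unfolding is_coproduct_def by blast
  then show ?thesis using that by blast
qed

lemma product_zero_mor:
  assumes pr: "is_product C I T P \<pi>" and x: "x \<in> hom C Z P" "\<And>i. i \<in> I \<Longrightarrow> is_zero_mor C (\<pi> i \<cdot> x)"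
  shows "is_zero_mor C x"
proof -
  have Z: "Z \<in> Obj C" "P \<in> Obj C" using x by (auto simp: hom_def)
  obtain z where z: "is_zero_mor C z" "z \<in> Arr C" "Dom C z = Z" "Cod C z = P"
    using zero_mor_exists Z by blast
  have pi: "\<pi> i \<in> hom C P (T i)" if "i \<in> I" for i using pr that by (auto simp: is_product_def)
  have "\<pi> i \<cdot> z = \<pi> i \<cdot> x" if "i \<in> I" for i
    by (rule zero_mor_unique) (use pi[OF that] z x that in \<open>auto simp: hom_def intro!: zero_mor_Comp_left\<close>)
  moreover have "\<forall>i\<in>I. \<pi> i \<cdot> x \<in> hom C Z (T i)" using pi x by (auto simp: hom_def)
  then have "\<exists>!u. u \<in> hom C Z P \<and> (\<forall>i\<in>I. \<pi> i \<cdot> u = \<pi> i \<cdot> x)"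
    using pr[unfolded is_product_def, THEN conjunct2, THEN conjunct2, rule_format, of Z "\<lambda>i. \<pi> i \<cdot> x"] Z
    by simp
  moreover have "z \<in> hom C Z P" using z by (auto simp: hom_def)
  ultimately have "z = x" using x by metis
  then show ?thesis using z by simp
qed

text \<open>On a coproduct these conditions determine \<open>e j\<close>: it is the passage through
  the coproduct that omits the \<open>j\<close>-th summand. Describing it by its effect on the
  inclusions lets identities between such endomorphisms be checked one summand at a time.\<close>

definition summand_killers :: "nat \<Rightarrow> 'a \<Rightarrow> (nat \<Rightarrow> 'b) \<Rightarrow> (nat \<Rightarrow> 'b) \<Rightarrow> bool" where
  "summand_killers m S \<iota> e \<longleftrightarrow> (\<forall>j<m. e j \<in> hom C S S \<and>
     (\<forall>i<m. if i = j then is_zero_mor C (e j \<cdot> \<iota> i) else e j \<cdot> \<iota> i = \<iota> i))"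

text \<open>The cosmash product only involves the commuting idempotents \<open>S \<rightarrow> T j \<rightarrow> S\<close>, so that
  the cube of partial coproducts never has to be considered.\<close>

lemma cosmash_joint_kernel:
  assumes "is_cosmash C m Y S \<iota> k"
  obtains e where "summand_killers m S \<iota> e" "joint_kernel {..<m} e k"
proof -
  obtain T \<kappa> P \<pi> r where cp: "is_coproduct C {..<m} Y S \<iota>"
    and T: "\<And>j. j < m \<Longrightarrow> is_coproduct C ({..<m} - {j}) Y (T j) (\<kappa> j)"
    and P: "is_product C {..<m} T P \<pi>" and r: "r \<in> hom C S P"
    and comp: "\<forall>j<m. \<forall>i<m. if i = j then is_zero_mor C (\<pi> j \<cdot> r \<cdot> \<iota> i) else \<pi> j \<cdot> r \<cdot> \<iota> i = \<kappa> j i"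
    and k: "is_kernel C r k"
    using assms unfolding is_cosmash_def by blast
  have i: "\<iota> i \<in> hom C (Y i) S" if "i < m" for i using cp that by (auto simp: is_coproduct_def)
  have S: "S \<in> Obj C" using cp by (auto simp: is_coproduct_def)
  have pi: "\<pi> j \<in> hom C P (T j)" if "j < m" for j using P that by (auto simp: is_product_def)
  have ka: "\<kappa> j i \<in> hom C (Y i) (T j)" if "j < m" "i < m" "i \<noteq> j" for i j
    using T[OF that(1)] that by (auto simp: is_coproduct_def)
  have "\<exists>s. s \<in> hom C (T j) S \<and> (\<forall>i<m. i \<noteq> j \<longrightarrow> s \<cdot> \<kappa> j i = \<iota> i)" if "j < m" for j
    using coproduct_lift[OF T[OF that] S, of \<iota>] i by (metis DiffE DiffI insert_iff empty_iff lessThan_iff)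
  then obtain s where s: "\<And>j. j < m \<Longrightarrow> s j \<in> hom C (T j) S"
    "\<And>i j. j < m \<Longrightarrow> i < m \<Longrightarrow> i \<noteq> j \<Longrightarrow> s j \<cdot> \<kappa> j i = \<iota> i"
    by metis
  define e where "e j = s j \<cdot> (\<pi> j \<cdot> r)" for j
  have pr: "\<pi> j \<cdot> r \<in> hom C S (T j)" if "j < m" for j using pi[OF that] r by (auto simp: hom_def)
  have e: "e j \<in> hom C S S" if "j < m" for j using pr[OF that] s(1)[OF that] by (auto simp: e_def hom_def)
  \<comment> \<open>\<open>T j\<close> is a retract of \<open>S\<close>. Hence an arrow into
    \<open>T j\<close> vanishes exactly when its composite with \<open>s j\<close> does, and
    \<open>e j\<close> kills the same arrows as the \<open>j\<close>-th component of
    \<open>r\<close>.\<close>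
  have sec: "(\<pi> j \<cdot> r) \<cdot> s j = Ident C (T j)" if j: "j < m" for j
  proof (rule coproduct_eqI[OF T[OF j]])
    have "T j \<in> Obj C" using T[OF j] by (simp add: is_coproduct_def)
    then show "(\<pi> j \<cdot> r) \<cdot> s j \<in> hom C (T j) (T j)" "Ident C (T j) \<in> hom C (T j) (T j)"
      using pr[OF j] s(1)[OF j] by (auto simp: hom_def)
    fix i assume "i \<in> {..<m} - {j}"
    then have im: "i < m" "i \<noteq> j" by auto
    have "(\<pi> j \<cdot> r) \<cdot> s j \<cdot> \<kappa> j i = (\<pi> j \<cdot> r) \<cdot> (s j \<cdot> \<kappa> j i)"
      using pr[OF j] s(1)[OF j] ka[OF j im] by (intro assoc) (auto simp: hom_def)
    also have "\<dots> = \<kappa> j i" using s(2)[OF j im] comp j im by auto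
    finally show "(\<pi> j \<cdot> r) \<cdot> s j \<cdot> \<kappa> j i = Ident C (T j) \<cdot> \<kappa> j i"
      using ka[OF j im] by (auto simp: hom_def)
  qed
  have zero_iff: "is_zero_mor C (e j \<cdot> x) \<longleftrightarrow> is_zero_mor C (\<pi> j \<cdot> (r \<cdot> x))"
    if j: "j < m" and x: "x \<in> Arr C" "Cod C x = S" for x j
  proof
    have 1: "e j \<cdot> x = s j \<cdot> (\<pi> j \<cdot> (r \<cdot> x))"
      using pi[OF j] r s(1)[OF j] x by (auto simp: e_def hom_def assoc)
    have "(\<pi> j \<cdot> r) \<cdot> (s j \<cdot> (\<pi> j \<cdot> (r \<cdot> x))) = ((\<pi> j \<cdot> r) \<cdot> s j) \<cdot> (\<pi> j \<cdot> (r \<cdot> x))"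
      using pi[OF j] pr[OF j] r s(1)[OF j] x by (intro assoc[symmetric]) (auto simp: hom_def)
    also have "\<dots> = \<pi> j \<cdot> (r \<cdot> x)" using sec[OF j] pi[OF j] r x by (auto simp: hom_def)
    finally have 2: "(\<pi> j \<cdot> r) \<cdot> (e j \<cdot> x) = \<pi> j \<cdot> (r \<cdot> x)" using 1 by simp
    { assume z: "is_zero_mor C (e j \<cdot> x)"
      have "is_zero_mor C ((\<pi> j \<cdot> r) \<cdot> (e j \<cdot> x))"
        by (rule zero_mor_Comp_left) (use z pr[OF j] e[OF j] x in \<open>auto simp: hom_def\<close>)
      then show "is_zero_mor C (\<pi> j \<cdot> (r \<cdot> x))" using 2 by simp }
    { assume z: "is_zero_mor C (\<pi> j \<cdot> (r \<cdot> x))"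
      have "is_zero_mor C (s j \<cdot> (\<pi> j \<cdot> (r \<cdot> x)))"
        by (rule zero_mor_Comp_left) (use z pi[OF j] s(1)[OF j] r x in \<open>auto simp: hom_def\<close>)
      then show "is_zero_mor C (e j \<cdot> x)" using 1 by simp }
  qed
  note K = kernelD[OF k]
  have "joint_kernel {..<m} e k"
    unfolding joint_kernel_def
  proof (intro conjI ballI impI)
    fix j assume "j \<in> {..<m}"
    then have j: "j < m" by simp
    have "is_zero_mor C (\<pi> j \<cdot> (r \<cdot> k))"
        by (rule zero_mor_Comp_left) (use K pi[OF j] r in \<open>auto simp: hom_def\<close>)
    then show "is_zero_mor C (e j \<cdot> k)" using zero_iff[OF j] K r by (auto simp: hom_def)
  next
    fix x assume x: "x \<in> Arr C" "Cod C x = Cod C k \<and> (\<forall>j\<in>{..<m}. is_zero_mor C (e j \<cdot> x))"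
    \<comment> \<open>An arrow into a product vanishes when all its components do; this leads back
      to the kernel of \<open>r\<close>.\<close>
    have "is_zero_mor C (r \<cdot> x)"
    proof (rule product_zero_mor[OF P])
      show "r \<cdot> x \<in> hom C (Dom C x) P" using x K r by (auto simp: hom_def)
      show "is_zero_mor C (\<pi> j \<cdot> (r \<cdot> x))" if "j \<in> {..<m}" for j
        using that x zero_iff[of j x] K r by (auto simp: hom_def)
    qed
    then obtain u where "u \<in> Arr C" "Dom C u = Dom C x" "Cod C u = Dom C k" "k \<cdot> u = x"
      using kernel_lift[OF k, of x] x K by auto
    then show "\<exists>u\<in>hom C (Dom C x) (Dom C k). k \<cdot> u = x" by (auto simp: hom_def)
  qed (rule K)
  moreover have "summand_killers m S \<iota> e"
    unfolding summand_killers_def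
  proof (intro allI impI conjI)
    fix j i assume ji: "j < m" "i < m"
    have 1: "e j \<cdot> \<iota> i = s j \<cdot> (\<pi> j \<cdot> r \<cdot> \<iota> i)"
      using pr[OF ji(1)] s(1)[OF ji(1)] i[OF ji(2)] by (auto simp: e_def hom_def assoc)
    have "\<iota> i \<in> Arr C" "Cod C (\<iota> i) = S" using i[OF ji(2)] by (auto simp: hom_def)
    moreover from this have "\<pi> j \<cdot> r \<cdot> \<iota> i = \<pi> j \<cdot> (r \<cdot> \<iota> i)"
      using pi[OF ji(1)] r by (intro assoc) (auto simp: hom_def)
    ultimately have 2: "is_zero_mor C (e j \<cdot> \<iota> i)" if "i = j"
      using that zero_iff[OF ji(1), of "\<iota> i"] comp[rule_format, OF ji] by simp
    show "if i = j then is_zero_mor C (e j \<cdot> \<iota> i) else e j \<cdot> \<iota> i = \<iota> i"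
      using 1 2 s(2)[OF ji] comp ji by auto
  qed (rule e)
  ultimately show ?thesis using that by blast
qed

text \<open>In either order, two killers annihilate both of their summands and fix the others, so
  the two sides agree on every inclusion.\<close>

lemma summand_killers_Comp:
  assumes "summand_killers m S \<iota> e" "is_coproduct C {..<m} Y S \<iota>" "i < m" "j < m"
  shows "e i \<cdot> e i = e i" "e i \<cdot> e j = e j \<cdot> e i"
proof -
  have e: "e j \<in> hom C S S" "\<And>i. i < m \<Longrightarrow> i \<noteq> j \<Longrightarrow> e j \<cdot> \<iota> i = \<iota> i" "is_zero_mor C (e j \<cdot> \<iota> j)"
    if "j < m" for j
    using assms(1) that unfolding summand_killers_def by (auto split: if_splits)
  have io: "\<iota> i \<in> hom C (Y i) S" if "i < m" for i
    using assms(2) that by (auto simp: is_coproduct_def)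
  have *: "e a \<cdot> e b \<cdot> \<iota> l = e a \<cdot> (e b \<cdot> \<iota> l)" if "a < m" "b < m" "l < m" for a b l
    using e(1)[of a] e(1)[of b] io[of l] that by (auto simp: hom_def assoc)
  have z: "is_zero_mor C (e a \<cdot> e b \<cdot> \<iota> l)" if "a < m" "b < m" "l < m" "l = a \<or> l = b" for a b l
  proof (cases "l = b")
    case True
    then show ?thesis using *[OF that(1-3)] e(1)[of a] e(1)[of b] e(3)[of b] io[of l] that
      by (auto simp: hom_def intro!: zero_mor_Comp_left)
  next
    \<comment> \<open>Here \<open>l = a\<close>: the inner killer fixes the summand and the outer
      one annihilates it.\<close>
    case False
    then show ?thesis using *[OF that(1-3)] e(2)[of b l] e(3)[of a] that by auto
  qed
  have nz: "e a \<cdot> e b \<cdot> \<iota> l = \<iota> l" if "a < m" "b < m" "l < m" "l \<noteq> a" "l \<noteq> b" for a b l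
    using *[OF that(1-3)] e(2)[of b l] e(2)[of a l] that by auto
  have ty: "e a \<cdot> e b \<in> hom C S S" if "a < m" "b < m" for a b
    using e(1)[of a] e(1)[of b] that by (auto simp: hom_def)
  have zty: "u \<cdot> \<iota> l \<in> hom C (Y l) S" if "u \<in> hom C S S" "l < m" for u l
    using io[of l] that by (auto simp: hom_def)
  show "e i \<cdot> e i = e i"
  proof (rule coproduct_eqI[OF assms(2) ty e(1)])
    fix l assume "l \<in> {..<m}"
    then have l: "l < m" by simp
    show "e i \<cdot> e i \<cdot> \<iota> l = e i \<cdot> \<iota> l"
    proof (cases "l = i")
      case True
      show ?thesis
        by (rule zero_mor_unique)
          (use l z[of i i l] e(3)[of i] zty[OF ty[of i i] l] zty[OF e(1)[of i] l] assms(3) True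
            in \<open>auto simp: hom_def\<close>)
    next
      case False
      then show ?thesis using nz[of i i l] e(2)[of i l] l assms by auto
    qed
  qed (use assms in auto)
  show "e i \<cdot> e j = e j \<cdot> e i"
  proof (rule coproduct_eqI[OF assms(2) ty ty])
    fix l assume "l \<in> {..<m}"
    then have l: "l < m" by simp
    show "e i \<cdot> e j \<cdot> \<iota> l = e j \<cdot> e i \<cdot> \<iota> l"
    proof (cases "l = i \<or> l = j")
      case True
      show ?thesis
        by (rule zero_mor_unique)
          (use l z[of i j l] z[of j i l] zty[OF ty[of i j] l] zty[OF ty[of j i] l] assms True
            in \<open>auto simp: hom_def\<close>)
    next
      case False
      then show ?thesis using nz[of i j l] nz[of j i l] l assms by auto
    qed
  qed (use assms in auto)
qed

end

section \<open>Rewriting composites; coequalizers and isomorphisms\<close>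

context category
begin

text \<open>Composites are mostly nested to the right, which hides a commuting square inside a
  longer composite; this rule and \<open>reassoc1\<close> apply it there.\<close>

lemma reassoc:
  assumes "g \<cdot> f = k \<cdot> h" "f \<in> Arr C" "g \<in> Arr C" "h \<in> Arr C" "k \<in> Arr C" "x \<in> Arr C"
    "Cod C x = Dom C f" "Cod C f = Dom C g" "Cod C h = Dom C k"
  shows "g \<cdot> (f \<cdot> x) = k \<cdot> (h \<cdot> x)"
proof -
  \<comment> \<open>Equal composites have equal domains, which makes \<open>h\<close> composable
    with \<open>x\<close>.\<close>
  have "Dom C h = Dom C f" using Comp_Arr(2)[of f g] Comp_Arr(2)[of h k] assms by metis
  then show ?thesis using assms assoc[of x f g] assoc[of x h k] by metis
qed

lemma reassoc1:
  assumes "g \<cdot> f = h" "f \<in> Arr C" "g \<in> Arr C" "x \<in> Arr C" "Cod C x = Dom C f" "Cod C f = Dom C g"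
  shows "g \<cdot> (f \<cdot> x) = h \<cdot> x"
  using assms assoc[of x f g] by metis

lemma coequalizer_lift:
  assumes "is_coequalizer C f g q" "h \<in> Arr C" "Dom C h = Cod C f" "h \<cdot> f = h \<cdot> g"
  obtains u where "u \<in> hom C (Cod C q) (Cod C h)" "u \<cdot> q = h"
proof -
  have "\<forall>A. \<forall>h\<in>hom C (Cod C f) A. h \<cdot> f = h \<cdot> g \<longrightarrow>
      (\<exists>!u. u \<in> hom C (Cod C q) A \<and> u \<cdot> q = h)"
    using assms(1) unfolding is_coequalizer_def by (elim conjE)
  moreover have "h \<in> hom C (Cod C f) (Cod C h)" using assms by (simp add: hom_def)
  ultimately have "\<exists>!u. u \<in> hom C (Cod C q) (Cod C h) \<and> u \<cdot> q = h"
    using assms(4) by simp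
  then show ?thesis using that by blast
qed

lemma isoE:
  assumes "is_iso C f"
  obtains g where "f \<in> Arr C" "g \<in> Arr C" "Dom C g = Cod C f" "Cod C g = Dom C f"
    "g \<cdot> f = Ident C (Dom C f)" "f \<cdot> g = Ident C (Cod C f)"
  using assms by (auto simp: is_iso_def hom_def)

lemma isoI:
  assumes "f \<in> Arr C" "g \<in> Arr C" "Dom C g = Cod C f" "Cod C g = Dom C f"
    "g \<cdot> f = Ident C (Dom C f)" "f \<cdot> g = Ident C (Cod C f)"
  shows "is_iso C f"
  using assms by (auto simp: is_iso_def hom_def)

text \<open>\<open>m \<cdot> c\<close> coequalizes the same pair as \<open>c\<close>: the inverse of
  \<open>m\<close> turns factorizations through \<open>c\<close> into factorizations through
  \<open>m \<cdot> c\<close>.\<close>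

lemma iso_Comp_regular_epi:
  assumes "is_regular_epi C c" "is_iso C m" "Cod C c = Dom C m"
  shows "is_regular_epi C (m \<cdot> c)"
proof -
  obtain f g where co: "is_coequalizer C f g c" using assms(1) by (auto simp: is_regular_epi_def)
  then have A: "f \<in> Arr C" "g \<in> Arr C" "c \<in> Arr C" "Dom C g = Dom C f" "Cod C g = Cod C f"
    "Dom C c = Cod C f" and eq: "c \<cdot> f = c \<cdot> g"
    by (auto simp: is_coequalizer_def)
  obtain n where N: "m \<in> Arr C" "n \<in> Arr C" "Dom C n = Cod C m" "Cod C n = Dom C m"
    and nm: "n \<cdot> m = Ident C (Dom C m)" "m \<cdot> n = Ident C (Cod C m)"
    using isoE[OF assms(2)] by metis
  have "is_coequalizer C f g (m \<cdot> c)"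
    unfolding is_coequalizer_def
  proof (intro conjI allI ballI impI)
    show "m \<cdot> c \<cdot> f = m \<cdot> c \<cdot> g" using A N assms(3) by (simp add: assoc eq)
    fix X h assume h: "h \<in> hom C (Cod C f) X" "h \<cdot> f = h \<cdot> g"
    then obtain u where u: "u \<in> hom C (Cod C c) X" "u \<cdot> c = h"
      using coequalizer_lift[OF co, of h] by (auto simp: hom_def)
    show "\<exists>!v. v \<in> hom C (Cod C (m \<cdot> c)) X \<and> v \<cdot> (m \<cdot> c) = h"
    proof (rule ex1I[of _ "u \<cdot> n"])
      have "u \<cdot> n \<cdot> (m \<cdot> c) = u \<cdot> (n \<cdot> (m \<cdot> c))"
        by (rule assoc) (use u(1) A N assms(3) in \<open>auto simp: hom_def\<close>)
      also have "n \<cdot> (m \<cdot> c) = c"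
        using reassoc1[OF nm(1), of c] A N assms(3) by simp
      finally show "u \<cdot> n \<in> hom C (Cod C (m \<cdot> c)) X \<and> u \<cdot> n \<cdot> (m \<cdot> c) = h"
        using u A N assms(3) by (auto simp: hom_def)
    next
      fix v assume v: "v \<in> hom C (Cod C (m \<cdot> c)) X \<and> v \<cdot> (m \<cdot> c) = h"
      have "v \<cdot> m \<cdot> c = v \<cdot> (m \<cdot> c)"
        by (rule assoc) (use v A N assms(3) in \<open>auto simp: hom_def\<close>)
      with v u have "v \<cdot> m \<cdot> c = u \<cdot> c" by simp
      then have "v \<cdot> m = u"
        by (rule coequalizer_unique[OF co, rotated -1]) (use u(1) v A N assms(3) in \<open>auto simp: hom_def\<close>)
      then have "u \<cdot> n = v \<cdot> m \<cdot> n" by simp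
      also have "\<dots> = v \<cdot> (m \<cdot> n)"
        by (rule assoc) (use v A N assms(3) in \<open>auto simp: hom_def\<close>)
      also have "\<dots> = v" using nm v A N assms(3) by (auto simp: hom_def)
      finally show "v = u \<cdot> n" by simp
    qed
  qed (use A N assms(3) in auto)
  then show ?thesis by (auto simp: is_regular_epi_def)
qed

end

subsection \<open>Regular epimorphisms in semi-abelian categories\<close>

locale semi_abelian_category = category +
  assumes semi_abelian: "semi_abelian C"

sublocale semi_abelian_category \<subseteq> pointed_category
  by unfold_locales (use semi_abelian in \<open>simp add: semi_abelian_def\<close>)

context semi_abelian_category
begin

lemma regular: "regular_category C"
  using semi_abelian by (simp add: semi_abelian_def barr_exact_def)

lemma pullback_exists:
  assumes "f \<in> Arr C" "g \<in> Arr C" "Cod C f = Cod C g"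
  obtains p q where "is_pullback C f g p q"
  using regular assms unfolding regular_category_def finitely_complete_def by blast

lemma pullback_regular_epi:
  assumes "is_pullback C f g p q" "is_regular_epi C g"
  shows "is_regular_epi C p"
  using regular assms unfolding regular_category_def by blast

text \<open>\<open>c\<close> is the coequalizer of the kernel pair of \<open>f\<close>. The induced
  \<open>m\<close> is monic because regular epimorphisms are stable under pullback: the kernel pair
  of \<open>m\<close> is covered by pairs that \<open>f\<close> identifies.\<close>

lemma image_factorization:
  assumes f: "f \<in> Arr C"
  obtains m c where "is_mono C m" "is_regular_epi C c" "Cod C c = Dom C m" "m \<cdot> c = f"
proof -
  obtain p q where pq: "is_pullback C f f p q" using pullback_exists f by blast
  note P = pullbackD[OF pq]
  obtain c where c: "is_coequalizer C p q c"
    using pq regular unfolding regular_category_def by blast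
  then have re: "is_regular_epi C c" by (auto simp: is_regular_epi_def)
  have cA: "c \<in> Arr C" "Dom C c = Cod C p" "c \<cdot> p = c \<cdot> q" using c by (auto simp: is_coequalizer_def)
  obtain m where m: "m \<in> hom C (Cod C c) (Cod C f)" and mc: "m \<cdot> c = f"
    by (rule coequalizer_lift[OF c f _ P(9)]) (use P in simp_all)
  from m have M: "m \<in> Arr C" "Dom C m = Cod C c" "Cod C m = Cod C f" by (simp_all add: hom_def)
  have "is_mono C m"
    unfolding is_mono_def
  proof (intro conjI ballI impI)
    fix u v assume uv: "u \<in> Arr C" "v \<in> Arr C" "Dom C u = Dom C v \<and> Cod C u = Dom C m \<and> Cod C v = Dom C m
      \<and> m \<cdot> u = m \<cdot> v"
    \<comment> \<open>It suffices that the two legs \<open>a\<close>, \<open>b\<close> of the kernel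
      pair of \<open>m\<close> are equal.\<close>
    obtain a b where ab: "is_pullback C m m a b" using pullback_exists M by blast
    note R = pullbackD[OF ab]
    \<comment> \<open>Two successive pullbacks of \<open>c\<close> cover the kernel pair: after
      restriction along \<open>w1 \<cdot> w2\<close>, the leg \<open>a\<close> lifts along
      \<open>c\<close> to \<open>x1 \<cdot> w2\<close> and the leg \<open>b\<close> lifts to
      \<open>x2\<close>.\<close>
    obtain w1 x1 where W1: "is_pullback C a c w1 x1"
      using pullback_exists[of a c] R(1-4,6-8) M cA(1,2) by auto
    note D1 = pullbackD[OF W1]
    obtain w2 x2 where W2: "is_pullback C (b \<cdot> w1) c w2 x2"
      using pullback_exists[of "b \<cdot> w1" c] R(1-4,6-8) M cA(1,2) D1(1-4,6-8) by auto
    note D2 = pullbackD[OF W2]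
    note T = R(1-4,6-8) D1(1-4,6-8) D2(1-4,6-8) M cA(1,2) P(1-4,6-8)
    have "f \<cdot> (x1 \<cdot> w2) = m \<cdot> (c \<cdot> (x1 \<cdot> w2))"
      by (rule reassoc1[OF mc, symmetric]) (use T in simp_all)
    also have "c \<cdot> (x1 \<cdot> w2) = a \<cdot> (w1 \<cdot> w2)"
      by (rule reassoc[OF D1(9)[symmetric]]) (use T in simp_all)
    also have "m \<cdot> (a \<cdot> (w1 \<cdot> w2)) = m \<cdot> (b \<cdot> (w1 \<cdot> w2))"
      by (rule reassoc[OF R(9)]) (use T in simp_all)
    also have "b \<cdot> (w1 \<cdot> w2) = c \<cdot> x2" using D2(9) assoc[of w2 w1 b] T by simp
    also have "m \<cdot> (c \<cdot> x2) = f \<cdot> x2" by (rule reassoc1[OF mc]) (use T in simp_all)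
    finally have "f \<cdot> (x1 \<cdot> w2) = f \<cdot> x2" .
    \<comment> \<open>\<open>f\<close> identifies the two lifts, so they come from its kernel pair,
      whose legs \<open>c\<close> identifies.\<close>
    then obtain t where t: "t \<in> Arr C" "Dom C t = Dom C x2" "Cod C t = Dom C p"
      "p \<cdot> t = x1 \<cdot> w2" "q \<cdot> t = x2"
      using pullback_lift[OF pq, of "x1 \<cdot> w2" x2] T by auto
    have "a \<cdot> (w1 \<cdot> w2) = c \<cdot> (x1 \<cdot> w2)"
      by (rule reassoc[OF D1(9)]) (use T in simp_all)
    also have "\<dots> = c \<cdot> (q \<cdot> t)"
      unfolding t(4)[symmetric] by (rule reassoc[OF cA(3)]) (use T t(1-3) in simp_all)
    also have "\<dots> = b \<cdot> w1 \<cdot> w2" using t(5) D2(9) by simp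
    finally have "a \<cdot> w1 \<cdot> w2 = b \<cdot> w1 \<cdot> w2" using assoc[of w2 w1 a] T by simp
    then have "a \<cdot> w1 = b \<cdot> w1"
      by (rule regular_epi_cancel[OF pullback_regular_epi[OF W2 re], rotated -1]) (use T in simp_all)
    then have "a = b"
      by (rule regular_epi_cancel[OF pullback_regular_epi[OF W1 re], rotated -1]) (use T in simp_all)
    moreover obtain w where "a \<cdot> w = u" "b \<cdot> w = v"
      using pullback_lift[OF ab, of u v] uv by auto
    ultimately show "u = v" by simp
  qed (rule M)
  then show ?thesis using that re M mc by simp
qed

text \<open>Converse of \<open>regular_epi_extremal\<close>: applied to the image of
  \<open>f\<close>, the hypothesis makes its monic part invertible.\<close>

lemma regular_epiI:
  assumes f: "f \<in> Arr C"
    and ext: "\<And>m g. is_mono C m \<Longrightarrow> g \<in> Arr C \<Longrightarrow> Cod C g = Dom C m \<Longrightarrow> m \<cdot> g = f \<Longrightarrow> is_iso C m"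
  shows "is_regular_epi C f"
proof -
  obtain m c where mc: "is_mono C m" "is_regular_epi C c" "Cod C c = Dom C m" "m \<cdot> c = f"
    using image_factorization[OF f] by metis
  then have "is_iso C m" using ext regular_epi_Arr by blast
  then show ?thesis using iso_Comp_regular_epi mc by metis
qed

text \<open>A monomorphism through which \<open>g\<close> factors is one through which
  \<open>g \<cdot> f\<close> factors, so it is invertible by
  \<open>regular_epi_extremal\<close>.\<close>

lemma regular_epi_left_factor:
  assumes "is_regular_epi C (g \<cdot> f)" "f \<in> Arr C" "g \<in> Arr C" "Cod C f = Dom C g"
  shows "is_regular_epi C g"
proof (rule regular_epiI)
  fix m h assume m: "is_mono C m" "h \<in> Arr C" "Cod C h = Dom C m" and eq: "m \<cdot> h = g"
  have M: "m \<in> Arr C" using m by (simp add: is_mono_def)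
  have D: "Dom C h = Dom C g" using Comp_Arr(2)[of h m] eq m M by simp
  have "m \<cdot> (h \<cdot> f) = g \<cdot> f"
    by (rule reassoc1[OF eq]) (use m M D assms in simp_all)
  then show "is_iso C m"
    by (rule regular_epi_extremal[OF assms(1) m(1), rotated -1]) (use m M D assms in simp_all)
qed (use assms in simp)

text \<open>The kernel is the pullback along an arrow out of a zero object; the other projection
  ends in that zero object and so carries no information.\<close>

lemma kernel_exists:
  assumes f: "f \<in> Arr C"
  obtains k where "is_kernel C f k"
proof -
  obtain Z where Z: "is_zero_obj C Z" using pointed by (auto simp: pointed_def)
  then have O: "Z \<in> Obj C" by (auto simp: is_zero_obj_def is_initial_def)
  obtain z where z: "is_zero_mor C z" "z \<in> Arr C" "Dom C z = Z" "Cod C z = Cod C f"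
    using zero_mor_exists O f by (metis Cod_Obj)
  obtain k t where pb: "is_pullback C f z k t" using pullback_exists[of f z] f z by auto
  note P = pullbackD[OF pb]
  have "is_kernel C f k"
    unfolding is_kernel_def
  proof (intro conjI allI ballI impI)
    show "is_zero_mor C (f \<cdot> k)"
      unfolding P(9) by (rule zero_mor_Comp_right) (use P z in simp_all)
    fix A h assume h: "h \<in> hom C A (Dom C f)" "is_zero_mor C (f \<cdot> h)"
    then have H: "h \<in> Arr C" "Dom C h = A" "Cod C h = Dom C f" "A \<in> Obj C" by (auto simp: hom_def)
    obtain y where y: "is_zero_mor C y" "y \<in> Arr C" "Dom C y = A" "Cod C y = Z"
      using zero_mor_exists O H by metis
    have "f \<cdot> h = z \<cdot> y"
      by (rule zero_mor_unique[OF h(2) zero_mor_Comp_left[OF y(1)]]) (use H y z f in simp_all)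
    then obtain u where u: "u \<in> Arr C" "Dom C u = A" "Cod C u = Dom C k" "k \<cdot> u = h"
      using pullback_lift[OF pb, of h y] H y z by auto
    show "\<exists>!u. u \<in> hom C A (Dom C k) \<and> k \<cdot> u = h"
    proof (rule ex1I[of _ u])
      show "u \<in> hom C A (Dom C k) \<and> k \<cdot> u = h" using u by (auto simp: hom_def)
      fix v assume v: "v \<in> hom C A (Dom C k) \<and> k \<cdot> v = h"
      then have V: "v \<in> Arr C" "Dom C v = A" "Cod C v = Dom C k" by (auto simp: hom_def)
      have "t \<cdot> v \<in> hom C A Z" "t \<cdot> u \<in> hom C A Z" using V u P z by (auto simp: hom_def)
      then have "t \<cdot> v = t \<cdot> u"
        using Z H(4) unfolding is_zero_obj_def is_terminal_def by blast
      then show "v = u"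
        by (rule pullback_unique[OF pb, rotated -1]) (use V u v in simp_all)
    qed
  qed (use P in simp_all)
  then show ?thesis using that by blast
qed

text \<open>A form of the short five lemma: after pulling back along the regular epimorphism \<open>q \<cdot> m\<close>,
  \<open>m\<close> becomes a morphism of points with the same kernel, to which protomodularity applies.\<close>

lemma mono_iso_of_kernel:
  assumes m: "is_mono C m" and q: "q \<in> Arr C" "Dom C q = Cod C m"
    and re: "is_regular_epi C (q \<cdot> m)"
    and ker: "\<And>x. x \<in> Arr C \<Longrightarrow> Cod C x = Dom C q \<Longrightarrow> is_zero_mor C (q \<cdot> x) \<Longrightarrow>
      \<exists>y\<in>Arr C. Dom C y = Dom C x \<and> Cod C y = Dom C m \<and> m \<cdot> y = x"
  shows "is_iso C m"
proof -
  have M: "m \<in> Arr C" using m by (simp add: is_mono_def)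
  let ?I = "Dom C m"
  have I: "?I \<in> Obj C" using M by simp
  \<comment> \<open>In elements, \<open>a1\<close> and \<open>a2\<close> project from pairs
    \<open>(i, i')\<close> with \<open>q (m i) = q (m i')\<close>, while \<open>b2\<close> and
    \<open>b1\<close> below project from pairs \<open>(x, i)\<close> with
    \<open>q x = q (m i)\<close>.\<close>
  obtain a1 a2 where a: "is_pullback C (q \<cdot> m) (q \<cdot> m) a1 a2"
    using pullback_exists[of "q \<cdot> m" "q \<cdot> m"] M q by auto
  note A = pullbackD[OF a]
  obtain b2 b1 where b: "is_pullback C q (q \<cdot> m) b2 b1"
    using pullback_exists[of q "q \<cdot> m"] M q by auto
  note B = pullbackD[OF b]
  note T = M q A(3,4,6-8) B(3,4,6-8)
  have Aeq: "q \<cdot> (m \<cdot> a1) = q \<cdot> (m \<cdot> a2)" using A(9) T by (simp add: assoc)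
  have Beq: "q \<cdot> b2 = q \<cdot> (m \<cdot> b1)" using B(9) T by (simp add: assoc)
  \<comment> \<open>The diagonal \<open>d\<close> and the section \<open>s\<close>, which is
    \<open>(m, 1)\<close>, make points of \<open>a1\<close> and \<open>b1\<close> over
    \<open>Dom C m\<close>.\<close>
  obtain d where d: "d \<in> Arr C" "Dom C d = ?I" "Cod C d = Dom C a1" "a1 \<cdot> d = Ident C ?I" "a2 \<cdot> d = Ident C ?I"
    using pullback_lift[OF a, of "Ident C ?I" "Ident C ?I"] I T by auto
  obtain s where s: "s \<in> Arr C" "Dom C s = ?I" "Cod C s = Dom C b2" "b2 \<cdot> s = m" "b1 \<cdot> s = Ident C ?I"
    using pullback_lift[OF b, of m "Ident C ?I"] I T by auto
  have "q \<cdot> (m \<cdot> a2) = q \<cdot> m \<cdot> a1" using Aeq T by (simp add: assoc)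
  \<comment> \<open>\<open>h\<close> sends \<open>(i, i')\<close> to
    \<open>(m i', i)\<close>.\<close>
  then obtain h where h: "h \<in> Arr C" "Dom C h = Dom C a1" "Cod C h = Dom C b2"
    "b2 \<cdot> h = m \<cdot> a2" "b1 \<cdot> h = a1"
    using pullback_lift[OF b, of "m \<cdot> a2" a1] T by auto
  have hd: "h \<cdot> d = s"
  proof (rule pullback_unique[OF b])
    have "b2 \<cdot> (h \<cdot> d) = m \<cdot> (a2 \<cdot> d)"
      by (rule reassoc[OF h(4)]) (use h(1-3) d(1-3) T in simp_all)
    then show "b2 \<cdot> (h \<cdot> d) = b2 \<cdot> s" using d s M by simp
    have "b1 \<cdot> (h \<cdot> d) = a1 \<cdot> d"
      by (rule reassoc1[OF h(5)]) (use h(1-3) d(1-3) T in simp_all)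
    then show "b1 \<cdot> (h \<cdot> d) = b1 \<cdot> s" using d s by simp
  qed (use h(1-3) d(1-3) s(1-3) T in simp_all)
  have pm: "is_point_mor C a1 d b1 s h"
    using h d s hd T by (simp add: is_point_mor_def is_point_def hom_def)
  obtain Z where Z: "is_zero_obj C Z" using pointed by (auto simp: pointed_def)
  then have O: "Z \<in> Obj C" by (auto simp: is_zero_obj_def is_initial_def)
  \<comment> \<open>Pulling back along the zero arrow \<open>v\<close> produces the kernels
    \<open>k\<close> and \<open>k'\<close> of \<open>a1\<close> and \<open>b1\<close>.\<close>
  obtain v where v: "is_zero_mor C v" "v \<in> Arr C" "Dom C v = Z" "Cod C v = ?I"
    using zero_mor_exists O I by metis
  obtain z k where zk: "is_pullback C v a1 z k" using pullback_exists[of v a1] v T by auto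
  note K = pullbackD[OF zk]
  obtain z' k' where zk': "is_pullback C v b1 z' k'" using pullback_exists[of v b1] v T by auto
  note K' = pullbackD[OF zk']
  note T' = T v(2-4) K(3,4,6-8) K'(3,4,6-8) h(1-3)
  have "b1 \<cdot> (h \<cdot> k) = a1 \<cdot> k"
    by (rule reassoc1[OF h(5)]) (use T' in simp_all)
  then have "v \<cdot> z = b1 \<cdot> (h \<cdot> k)" using K(9) by simp
  then obtain u where u: "u \<in> Arr C" "Dom C u = Dom C k" "Cod C u = Dom C z'" "z' \<cdot> u = z" "k' \<cdot> u = h \<cdot> k"
    using pullback_lift[OF zk', of z "h \<cdot> k"] T' by auto
  have zero_bk: "is_zero_mor C (b1 \<cdot> k')"
    unfolding K'(9)[symmetric] by (rule zero_mor_Comp_right[OF v(1)]) (use T' in simp_all)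
  have "q \<cdot> (b2 \<cdot> k') = q \<cdot> m \<cdot> (b1 \<cdot> k')"
    by (rule reassoc[OF B(9)]) (use T' in simp_all)
  moreover have "is_zero_mor C (q \<cdot> m \<cdot> (b1 \<cdot> k'))"
    by (rule zero_mor_Comp_left[OF zero_bk]) (use T' in simp_all)
  ultimately have zq: "is_zero_mor C (q \<cdot> (b2 \<cdot> k'))" by simp
  \<comment> \<open>\<open>k'\<close> runs through the pairs \<open>(x, 0)\<close> with
    \<open>x\<close> killed by \<open>q\<close>. By \<open>ker\<close>, such an \<open>x\<close> is
    \<open>m y\<close>, so \<open>k'\<close> is the image under \<open>h\<close> of the pair
    \<open>(0, y)\<close>, called \<open>w\<close>.\<close>
  then obtain y where y: "y \<in> Arr C" "Dom C y = Dom C k'" "Cod C y = ?I" "m \<cdot> y = b2 \<cdot> k'"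
    using ker[of "b2 \<cdot> k'"] T' by auto
  have "q \<cdot> m \<cdot> (b1 \<cdot> k') = q \<cdot> m \<cdot> y"
  proof (rule zero_mor_unique)
    show "is_zero_mor C (q \<cdot> m \<cdot> y)"
      using zq y(4) assoc[of y m q] y(1-3) T' by simp
  qed (use \<open>is_zero_mor C (q \<cdot> m \<cdot> (b1 \<cdot> k'))\<close> y(1-3) T' in simp_all)
  then obtain w where w: "w \<in> Arr C" "Dom C w = Dom C k'" "Cod C w = Dom C a1" "a1 \<cdot> w = b1 \<cdot> k'" "a2 \<cdot> w = y"
    using pullback_lift[OF a, of "b1 \<cdot> k'" y] y(1-3) T' by auto
  have hw: "h \<cdot> w = k'"
  proof (rule pullback_unique[OF b])
    have "b2 \<cdot> (h \<cdot> w) = m \<cdot> (a2 \<cdot> w)"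
      by (rule reassoc[OF h(4)]) (use w(1-3) T' in simp_all)
    then show "b2 \<cdot> (h \<cdot> w) = b2 \<cdot> k'" using w y by simp
    have "b1 \<cdot> (h \<cdot> w) = a1 \<cdot> w"
      by (rule reassoc1[OF h(5)]) (use w(1-3) T' in simp_all)
    then show "b1 \<cdot> (h \<cdot> w) = b1 \<cdot> k'" using w by simp
  qed (use w(1-3) T' in simp_all)
  have "v \<cdot> z' = a1 \<cdot> w" using K'(9) w by simp
  then obtain r where r: "r \<in> Arr C" "Dom C r = Dom C w" "Cod C r = Dom C z" "z \<cdot> r = z'" "k \<cdot> r = w"
    using pullback_lift[OF zk, of z' w] w(1-3) T' by auto
  have ur: "u \<cdot> r = Ident C (Dom C z')"
  proof (rule pullback_unique[OF zk'])
    have "z' \<cdot> (u \<cdot> r) = z \<cdot> r"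
      by (rule reassoc1[OF u(4)]) (use u(1-3) r(1-3) w(1-3) T' in simp_all)
    then show "z' \<cdot> (u \<cdot> r) = z' \<cdot> Ident C (Dom C z')" using r(4) T' by simp
    have "k' \<cdot> (u \<cdot> r) = h \<cdot> (k \<cdot> r)"
      by (rule reassoc[OF u(5)]) (use u(1-3) r(1-3) w(1-3) T' in simp_all)
    then show "k' \<cdot> (u \<cdot> r) = k' \<cdot> Ident C (Dom C z')" using r(5) hw T' by simp
  qed (use u(1-3) r(1-3) w(1-3) T' in simp_all)
  have "is_mono C h"
    unfolding is_mono_def
  proof (intro conjI ballI impI)
    fix f g assume "f \<in> Arr C" "g \<in> Arr C" "Dom C f = Dom C g \<and> Cod C f = Dom C h \<and> Cod C g = Dom C h
      \<and> h \<cdot> f = h \<cdot> g"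
    then have F: "f \<in> Arr C" "g \<in> Arr C" "Dom C f = Dom C g" "Cod C f = Dom C a1" "Cod C g = Dom C a1"
      and eq: "h \<cdot> f = h \<cdot> g"
      using h by simp_all
    have 1: "a1 \<cdot> x = b1 \<cdot> (h \<cdot> x)" "m \<cdot> (a2 \<cdot> x) = b2 \<cdot> (h \<cdot> x)" if "x \<in> Arr C" "Cod C x = Dom C a1" for x
      by (rule reassoc1[OF h(5), symmetric] reassoc[OF h(4), symmetric], use that T' in simp_all)+
    have "m \<cdot> (a2 \<cdot> f) = m \<cdot> (a2 \<cdot> g)" "a1 \<cdot> f = a1 \<cdot> g" using 1 F eq by simp_all
    moreover from this(1) have "a2 \<cdot> f = a2 \<cdot> g"
      by (rule monoD[OF m, rotated -1]) (use F T' in simp_all)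
    ultimately show "f = g"
      by (intro pullback_unique[OF a F(1-3)]) (use F in simp_all)
  qed (rule h)
  \<comment> \<open>Composites with \<open>z\<close> end in a zero object, so two arrows that
    \<open>k\<close> identifies have equal composites with \<open>z\<close> too.\<close>
  have "is_mono C k"
    unfolding is_mono_def
  proof (intro conjI ballI impI)
    fix f g assume F: "f \<in> Arr C" "g \<in> Arr C" "Dom C f = Dom C g \<and> Cod C f = Dom C k \<and> Cod C g = Dom C k
      \<and> k \<cdot> f = k \<cdot> g"
    have "z \<cdot> f \<in> hom C (Dom C g) Z" "z \<cdot> g \<in> hom C (Dom C g) Z" "Dom C g \<in> Obj C"
      using F T' by (auto simp: hom_def)
    then have "z \<cdot> f = z \<cdot> g"
      using Z unfolding is_zero_obj_def is_terminal_def by blast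
    then show "f = g"
      by (rule pullback_unique[OF zk, rotated -2]) (use F T' in simp_all)
  qed (rule K)
  \<comment> \<open>\<open>h \<cdot> k = k' \<cdot> u\<close> with \<open>h\<close> and
    \<open>k\<close> monic makes \<open>u\<close> monic, and \<open>r\<close> is a right inverse of
    it.\<close>
  have "is_mono C u"
    unfolding is_mono_def
  proof (intro conjI ballI impI)
    fix f g assume "f \<in> Arr C" "g \<in> Arr C" "Dom C f = Dom C g \<and> Cod C f = Dom C u \<and> Cod C g = Dom C u
      \<and> u \<cdot> f = u \<cdot> g"
    then have F: "f \<in> Arr C" "g \<in> Arr C" "Dom C f = Dom C g" "Cod C f = Dom C k" "Cod C g = Dom C k"
      and eq: "u \<cdot> f = u \<cdot> g"
      using u by simp_all
    have "h \<cdot> (k \<cdot> x) = k' \<cdot> (u \<cdot> x)" if "x \<in> Arr C" "Cod C x = Dom C k" for x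
      by (rule reassoc[OF u(5), symmetric]) (use that u(1-3) T' in simp_all)
    then have "h \<cdot> (k \<cdot> f) = h \<cdot> (k \<cdot> g)" using F eq by simp
    then have "k \<cdot> f = k \<cdot> g"
      by (rule monoD[OF \<open>is_mono C h\<close>, rotated -1]) (use F T' in simp_all)
    then show "f = g"
      by (rule monoD[OF \<open>is_mono C k\<close>, rotated -1]) (use F in simp_all)
  qed (rule u)
  then have "is_iso C u"
    by (rule mono_split_iso[where u = r]) (use ur u(1-3) r(1-3) w(1-3) T' in \<open>simp_all add: hom_def\<close>)
  moreover have "protomodular C" using semi_abelian by (simp add: semi_abelian_def)
  moreover have "u \<in> hom C (Dom C z) (Dom C z')" using u(1-3) T' by (simp add: hom_def)
  ultimately have "is_iso C h"
    using pm zk zk' u(4,5) v(2) unfolding protomodular_def by blast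
  then obtain g where g: "g \<in> Arr C" "Dom C g = Cod C h" "Cod C g = Dom C h" "h \<cdot> g = Ident C (Cod C h)"
    using isoE by metis
  \<comment> \<open>\<open>b2\<close> is a pullback of \<open>q \<cdot> m\<close>, hence a regular
    epimorphism, and the inverse of \<open>h\<close> makes it factor through
    \<open>m\<close>.\<close>
  have "m \<cdot> (a2 \<cdot> g) = b2 \<cdot> (h \<cdot> g)"
    by (rule reassoc[OF h(4)[symmetric]]) (use g(1-3) T' in simp_all)
  then have "m \<cdot> (a2 \<cdot> g) = b2" using g T' by simp
  then show ?thesis
    by (rule regular_epi_extremal[OF pullback_regular_epi[OF b re] m, rotated -1]) (use g(1-3) T' in simp_all)
qed

end

section \<open>Idempotents and regular epimorphisms between their kernels\<close>

context semi_abelian_category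
begin

text \<open>The image factorization of \<open>e\<close> splits it: in
  \<open>s \<cdot> p \<cdot> s \<cdot> p = s \<cdot> p\<close> the monic \<open>s\<close> cancels on
  the left and the regular epimorphism \<open>p\<close> on the right.\<close>

lemma split_idempotent:
  assumes e: "e \<in> hom C A A" "e \<cdot> e = e"
  obtains T p s where "p \<in> hom C A T" "s \<in> hom C T A" "s \<cdot> p = e" "p \<cdot> s = Ident C T"
    "is_mono C s" "is_regular_epi C p"
proof -
  have E: "e \<in> Arr C" "Dom C e = A" "Cod C e = A" using e by (simp_all add: hom_def)
  obtain s p where sp: "is_mono C s" "is_regular_epi C p" "Cod C p = Dom C s" and eq: "s \<cdot> p = e"
    using image_factorization[OF E(1)] by metis
  have S: "s \<in> Arr C" "p \<in> Arr C" using sp regular_epi_Arr by (simp_all add: is_mono_def)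
  have D: "Dom C p = A" "Cod C s = A" using Comp_Arr(2,3)[of p s] S sp(3) eq E by simp_all
  note T = S D sp(3)
  have "s \<cdot> (p \<cdot> s \<cdot> p) = s \<cdot> p \<cdot> (s \<cdot> p)" using T by (simp add: assoc)
  then have "s \<cdot> (p \<cdot> s \<cdot> p) = s \<cdot> p" using eq e(2) by simp
  then have "p \<cdot> s \<cdot> p = p"
    by (rule monoD[OF sp(1), rotated -1]) (use T in simp_all)
  then have "p \<cdot> s \<cdot> p = Ident C (Dom C s) \<cdot> p" using T by simp
  then have "p \<cdot> s = Ident C (Dom C s)"
    by (rule regular_epi_cancel[OF sp(2), rotated -1]) (use T in simp_all)
  then show ?thesis
    using that[of p "Dom C s" s] T sp eq by (simp add: hom_def)
qed

text \<open>Splitting both idempotents gives a square from \<open>p\<close> to \<open>q\<close>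
  whose comparison \<open>h\<close> into the pullback is a regular epimorphism, and
  \<open>\<phi>\<close> is a pullback of \<open>h\<close>. For arbitrary endomorphisms this fails:
  multiplication by 2 on the integers lies over zero on the integers modulo 2, but the first kernel
  is trivial and the second is not.\<close>

lemma idempotent_kernel_regular_epi:
  assumes f: "f \<in> hom C A B" "is_regular_epi C f"
    and d: "d \<in> hom C A A" "d \<cdot> d = d" and e: "e \<in> hom C B B" "e \<cdot> e = e"
    and fd: "f \<cdot> d = e \<cdot> f"
    and k: "is_kernel C d k" and l: "is_kernel C e l"
    and \<phi>: "\<phi> \<in> hom C (Dom C k) (Dom C l)" "l \<cdot> \<phi> = f \<cdot> k"
  shows "is_regular_epi C \<phi>"
proof -
  obtain T p s where T: "p \<in> hom C A T" "s \<in> hom C T A" and sp: "s \<cdot> p = d" and ps: "p \<cdot> s = Ident C T"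
    and sm: "is_mono C s"
    using split_idempotent[OF d] by metis
  obtain U q t where U: "q \<in> hom C B U" "t \<in> hom C U B" and tq: "t \<cdot> q = e" and qt: "q \<cdot> t = Ident C U"
    and tm: "is_mono C t"
    using split_idempotent[OF e] by metis
  have K: "k \<in> Arr C" "Cod C k = A" "l \<in> Arr C" "Cod C l = B"
    using kernelD(1-3)[OF k] kernelD(1-3)[OF l] d e by (simp_all add: hom_def)
  have Y: "f \<in> Arr C" "Dom C f = A" "Cod C f = B" "p \<in> Arr C" "Dom C p = A" "Cod C p = T"
    "s \<in> Arr C" "Dom C s = T" "Cod C s = A" "q \<in> Arr C" "Dom C q = B" "Cod C q = U"
    "t \<in> Arr C" "Dom C t = U" "Cod C t = B" "\<phi> \<in> Arr C" "Dom C \<phi> = Dom C k" "Cod C \<phi> = Dom C l"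
    "d \<in> Arr C" "Dom C d = A" "Cod C d = A" "e \<in> Arr C" "Dom C e = B" "Cod C e = B"
    using f T U \<phi>(1) d e by (simp_all add: hom_def)
  note Y = Y K
  have O: "T \<in> Obj C" "U \<in> Obj C" using Dom_Obj[of s] Dom_Obj[of t] Y by simp_all
  have ds: "d \<cdot> s = s"
    using sp ps assoc[of s p s] Y O by auto
  have qe: "q \<cdot> e = q"
    using tq qt assoc[of q t q] Y O by auto
  \<comment> \<open>\<open>g\<close> is what \<open>f\<close> induces between the images of the
    idempotents; it is compatible with the sections (\<open>tg\<close>) and with the retractions
    (\<open>gp\<close>).\<close>
  define g where "g = q \<cdot> (f \<cdot> s)"
  have G: "g \<in> Arr C" "Dom C g = T" "Cod C g = U" using Y by (simp_all add: g_def)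
  have tg: "t \<cdot> g = f \<cdot> s"
  proof -
    have "t \<cdot> g = e \<cdot> (f \<cdot> s)"
      unfolding g_def by (rule reassoc1[OF tq]) (use Y in simp_all)
    also have "\<dots> = f \<cdot> (d \<cdot> s)"
      by (rule reassoc[OF fd[symmetric]]) (use Y in simp_all)
    finally show ?thesis using ds by simp
  qed
  have gp: "g \<cdot> p = q \<cdot> f"
  proof -
    have "g \<cdot> p = q \<cdot> (f \<cdot> (s \<cdot> p))" using Y by (simp add: g_def assoc)
    also have "\<dots> = q \<cdot> (e \<cdot> f)" using sp fd by simp
    also have "\<dots> = q \<cdot> f" by (rule reassoc1[OF qe]) (use Y in simp_all)
    finally show ?thesis .
  qed
  obtain q1 q2 where pb: "is_pullback C g q q1 q2" using pullback_exists[of g q] G Y by auto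
  note P = pullbackD[OF pb]
  note X = Y G P(3,4,6-8)
  obtain h where h: "h \<in> Arr C" "Dom C h = A" "Cod C h = Dom C q1" and h1: "q1 \<cdot> h = p" and h2: "q2 \<cdot> h = f"
    using pullback_lift[OF pb, of p f] gp X by auto
  note X = X h
  \<comment> \<open>If \<open>h\<close> factors through a monomorphism \<open>m\<close>, then
    \<open>f\<close> factors through \<open>q2 \<cdot> m\<close>, which is thus a regular
    epimorphism. By \<open>mono_iso_of_kernel\<close> it remains to see that the kernel of
    \<open>q2\<close> lies in \<open>m\<close>.\<close>
  have "is_regular_epi C h"
  proof (rule regular_epiI[OF h(1)])
    fix m a assume m: "is_mono C m" "a \<in> Arr C" "Cod C a = Dom C m" and ma: "m \<cdot> a = h"
    have M: "m \<in> Arr C" using m by (simp add: is_mono_def)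
    have D: "Dom C a = A" "Cod C m = Dom C q1" using Comp_Arr(2,3)[of a m] m M ma h by simp_all
    note X = X m(2,3) M D
    show "is_iso C m"
    proof (rule mono_iso_of_kernel[OF m(1), of q2])
      have "q2 \<cdot> m \<cdot> a = f" using ma h2 assoc[of a m q2] X by simp
      then show "is_regular_epi C (q2 \<cdot> m)"
        using regular_epi_left_factor[of "q2 \<cdot> m" a] f(2) X by simp
      fix x assume x: "x \<in> Arr C" "Cod C x = Dom C q2" and z: "is_zero_mor C (q2 \<cdot> x)"
      \<comment> \<open>An \<open>x\<close> killed by \<open>q2\<close> is determined by
        \<open>q1 \<cdot> x\<close>, which \<open>s\<close> lifts to \<open>A\<close>; the image of
        this lift under \<open>f\<close> is \<open>t \<cdot> (q \<cdot> (q2 \<cdot> x))\<close>, so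
        it vanishes as well.\<close>
      have xh: "x = h \<cdot> (s \<cdot> (q1 \<cdot> x))"
      proof (rule pullback_unique[OF pb])
        have "q1 \<cdot> (h \<cdot> (s \<cdot> (q1 \<cdot> x))) = p \<cdot> (s \<cdot> (q1 \<cdot> x))"
          by (rule reassoc1[OF h1]) (use X x in simp_all)
        also have "\<dots> = Ident C T \<cdot> (q1 \<cdot> x)"
          by (rule reassoc1[OF ps]) (use X x in simp_all)
        finally show "q1 \<cdot> x = q1 \<cdot> (h \<cdot> (s \<cdot> (q1 \<cdot> x)))" using X x by simp
        have "q2 \<cdot> (h \<cdot> (s \<cdot> (q1 \<cdot> x))) = f \<cdot> (s \<cdot> (q1 \<cdot> x))"
          by (rule reassoc1[OF h2]) (use X x in simp_all)
        also have "\<dots> = t \<cdot> (g \<cdot> (q1 \<cdot> x))"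
          by (rule reassoc[OF tg[symmetric]]) (use X x in simp_all)
        also have "g \<cdot> (q1 \<cdot> x) = q \<cdot> (q2 \<cdot> x)"
          by (rule reassoc[OF P(9)]) (use X x in simp_all)
        finally have eq: "q2 \<cdot> (h \<cdot> (s \<cdot> (q1 \<cdot> x))) = t \<cdot> (q \<cdot> (q2 \<cdot> x))" .
        have "is_zero_mor C (t \<cdot> (q \<cdot> (q2 \<cdot> x)))"
          by (intro zero_mor_Comp_left z) (use X x in simp_all)
        then show "q2 \<cdot> x = q2 \<cdot> (h \<cdot> (s \<cdot> (q1 \<cdot> x)))"
          unfolding eq by (rule zero_mor_unique[OF z]) (use X x in simp_all)
      qed (use X x in simp_all)
      also have "\<dots> = m \<cdot> (a \<cdot> (s \<cdot> (q1 \<cdot> x)))"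
        by (rule reassoc1[OF ma, symmetric]) (use X x in simp_all)
      finally have "m \<cdot> (a \<cdot> (s \<cdot> (q1 \<cdot> x))) = x" by simp
      moreover have "a \<cdot> (s \<cdot> (q1 \<cdot> x)) \<in> Arr C" "Dom C (a \<cdot> (s \<cdot> (q1 \<cdot> x))) = Dom C x"
        "Cod C (a \<cdot> (s \<cdot> (q1 \<cdot> x))) = Dom C m"
        using X x by simp_all
      ultimately show "\<exists>y\<in>Arr C. Dom C y = Dom C x \<and> Cod C y = Dom C m \<and> m \<cdot> y = x" by blast
    qed (use X in simp_all)
  qed
  text \<open>Now \<open>\<phi>\<close> is the pullback of \<open>h\<close> along \<open>(0, l)\<close>.\<close>
  obtain z where z: "is_zero_mor C z" "z \<in> Arr C" "Dom C z = Dom C l" "Cod C z = T"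
    using zero_mor_exists[OF Dom_Obj[OF K(3)] O(1)] by metis
  have zero_q: "is_zero_mor C (q \<cdot> l)"
  proof (rule zero_mor_cancel_mono[OF tm])
    have "t \<cdot> (q \<cdot> l) = e \<cdot> l" by (rule reassoc1[OF tq]) (use X in simp_all)
    then show "is_zero_mor C (t \<cdot> (q \<cdot> l))" using kernelD(4)[OF l] by simp
  qed (use X in simp_all)
  have "g \<cdot> z = q \<cdot> l"
    by (rule zero_mor_unique[OF zero_mor_Comp_left[OF z(1)] zero_q]) (use X z in simp_all)
  then obtain j where j: "j \<in> Arr C" "Dom C j = Dom C l" "Cod C j = Dom C q1" and j1: "q1 \<cdot> j = z" and j2: "q2 \<cdot> j = l"
    using pullback_lift[OF pb, of z l] X z(2-4) by auto
  note X = X j z(2-4)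
  have zero_p: "is_zero_mor C (p \<cdot> y)" if "y \<in> Arr C" "Cod C y = A" "is_zero_mor C (d \<cdot> y)" for y
  proof (rule zero_mor_cancel_mono[OF sm])
    have "s \<cdot> (p \<cdot> y) = d \<cdot> y" by (rule reassoc1[OF sp]) (use X that(1,2) in simp_all)
    then show "is_zero_mor C (s \<cdot> (p \<cdot> y))" using that by simp
  qed (use X that(1,2) in simp_all)
  have "is_pullback C j h \<phi> k"
    unfolding is_pullback_def
  proof (intro conjI allI impI)
    show jk: "j \<cdot> \<phi> = h \<cdot> k"
    proof (rule pullback_unique[OF pb])
      have "q1 \<cdot> (j \<cdot> \<phi>) = z \<cdot> \<phi>" by (rule reassoc1[OF j1]) (use X in simp_all)
      moreover have "q1 \<cdot> (h \<cdot> k) = p \<cdot> k" by (rule reassoc1[OF h1]) (use X in simp_all)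
      moreover have "z \<cdot> \<phi> = p \<cdot> k"
        by (rule zero_mor_unique[OF zero_mor_Comp_right[OF z(1)] zero_p]) (use X kernelD(4)[OF k] in simp_all)
      ultimately show "q1 \<cdot> (j \<cdot> \<phi>) = q1 \<cdot> (h \<cdot> k)" by simp
      have "q2 \<cdot> (j \<cdot> \<phi>) = l \<cdot> \<phi>" by (rule reassoc1[OF j2]) (use X in simp_all)
      moreover have "q2 \<cdot> (h \<cdot> k) = f \<cdot> k" by (rule reassoc1[OF h2]) (use X in simp_all)
      ultimately show "q2 \<cdot> (j \<cdot> \<phi>) = q2 \<cdot> (h \<cdot> k)" using \<phi>(2) by simp
    qed (use X in simp_all)
    fix D a b assume "a \<in> hom C D (Dom C j) \<and> b \<in> hom C D (Dom C h) \<and> j \<cdot> a = h \<cdot> b"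
    then have ab: "a \<in> Arr C" "Dom C a = D" "Cod C a = Dom C l" "b \<in> Arr C" "Dom C b = D" "Cod C b = A"
      and jh: "j \<cdot> a = h \<cdot> b"
      using X by (simp_all add: hom_def)
    \<comment> \<open>The first component of \<open>j \<cdot> a = h \<cdot> b\<close> says that
      \<open>p\<close>, hence \<open>d\<close>, kills \<open>b\<close>; so \<open>b\<close> factors
      through \<open>k\<close>.\<close>
    have "z \<cdot> a = q1 \<cdot> (j \<cdot> a)" by (rule reassoc1[OF j1, symmetric]) (use X ab in simp_all)
    also have "\<dots> = p \<cdot> b" unfolding jh by (rule reassoc1[OF h1]) (use X ab in simp_all)
    finally have "is_zero_mor C (p \<cdot> b)" using zero_mor_Comp_right[OF z(1), of a] X ab by simp
    then have "is_zero_mor C (s \<cdot> (p \<cdot> b))"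
      by (rule zero_mor_Comp_left) (use X ab in simp_all)
    moreover have "s \<cdot> (p \<cdot> b) = d \<cdot> b" by (rule reassoc1[OF sp]) (use X ab in simp_all)
    ultimately obtain u where u: "u \<in> Arr C" "Dom C u = D" "Cod C u = Dom C k" "k \<cdot> u = b"
      using kernel_lift[OF k, of b] X ab by auto
    have "l \<cdot> (\<phi> \<cdot> u) = f \<cdot> (k \<cdot> u)" by (rule reassoc[OF \<phi>(2)]) (use X u(1-3) in simp_all)
    also have "\<dots> = q2 \<cdot> (h \<cdot> b)" unfolding u(4) by (rule reassoc1[OF h2, symmetric]) (use X ab in simp_all)
    also have "\<dots> = l \<cdot> a" unfolding jh[symmetric] by (rule reassoc1[OF j2]) (use X ab in simp_all)
    finally have pu: "\<phi> \<cdot> u = a"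
      by (rule monoD[OF kernelD(5)[OF l], rotated -1]) (use X u(1-3) ab in simp_all)
    show "\<exists>!u. u \<in> hom C D (Dom C \<phi>) \<and> \<phi> \<cdot> u = a \<and> k \<cdot> u = b"
    proof (rule ex1I[of _ u])
      show "u \<in> hom C D (Dom C \<phi>) \<and> \<phi> \<cdot> u = a \<and> k \<cdot> u = b" using u pu X by (simp add: hom_def)
      fix w assume w: "w \<in> hom C D (Dom C \<phi>) \<and> \<phi> \<cdot> w = a \<and> k \<cdot> w = b"
      then have "k \<cdot> w = k \<cdot> u" using u by simp
      then show "w = u"
        by (rule monoD[OF kernelD(5)[OF k], rotated -1]) (use w u(1-3) X in \<open>simp_all add: hom_def\<close>)
    qed
  qed (use X in simp_all)
  then show ?thesis by (rule pullback_regular_epi) fact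
qed

text \<open>Induction on the number of idempotents. The joint kernels are built along the way, each
  from the kernel of one more idempotent restricted to the previous joint kernel; hence the
  existential form. Restrictions of idempotents are again idempotent, so
  \<open>idempotent_kernel_regular_epi\<close> applies at each stage.\<close>

lemma joint_kernel_regular_epi:
  fixes m :: nat
  assumes f: "f \<in> hom C A B" "is_regular_epi C f"
    and d: "\<And>i. i < m \<Longrightarrow> d i \<in> hom C A A" "\<And>i. i < m \<Longrightarrow> d i \<cdot> d i = d i"
      "\<And>i j. i < m \<Longrightarrow> j < m \<Longrightarrow> d i \<cdot> d j = d j \<cdot> d i"
    and e: "\<And>i. i < m \<Longrightarrow> e i \<in> hom C B B" "\<And>i. i < m \<Longrightarrow> e i \<cdot> e i = e i"
      "\<And>i j. i < m \<Longrightarrow> j < m \<Longrightarrow> e i \<cdot> e j = e j \<cdot> e i"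
    and fd: "\<And>i. i < m \<Longrightarrow> f \<cdot> d i = e i \<cdot> f"
  shows "\<exists>k l \<phi>. joint_kernel {..<m} d k \<and> joint_kernel {..<m} e l \<and> Cod C k = A \<and> Cod C l = B \<and>
    \<phi> \<in> hom C (Dom C k) (Dom C l) \<and> is_regular_epi C \<phi> \<and> l \<cdot> \<phi> = f \<cdot> k"
  using assms
proof (induction m)
  case 0
  have F: "f \<in> Arr C" "Dom C f = A" "Cod C f = B" using f by (simp_all add: hom_def)
  then have O: "A \<in> Obj C" "B \<in> Obj C" using Dom_Obj[of f] Cod_Obj[of f] by simp_all
  \<comment> \<open>With nothing to kill, identities are joint kernels and \<open>f\<close> itself
    is the comparison.\<close>
  have jk: "joint_kernel {..<0::nat} c (Ident C Y)" if "Y \<in> Obj C" for c Y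
    unfolding joint_kernel_def
  proof (intro conjI ballI impI)
    show "is_mono C (Ident C Y)"
      using that Ident_neutral(2) unfolding is_mono_def by (metis Ident_Arr)
    fix x assume "x \<in> Arr C" "Cod C x = Cod C (Ident C Y) \<and> (\<forall>j\<in>{..<0}. is_zero_mor C (c j \<cdot> x))"
    then show "\<exists>u\<in>hom C (Dom C x) (Dom C (Ident C Y)). Ident C Y \<cdot> u = x"
      using that by (intro bexI[of _ x]) (simp_all add: hom_def)
  qed simp
  show ?case
    using jk[OF O(1), of d] jk[OF O(2), of e] f F O
    by (intro exI[of _ "Ident C A"] exI[of _ "Ident C B"] exI[of _ f]) simp
next
  case (Suc m)
  have "\<exists>k l \<phi>. joint_kernel {..<m} d k \<and> joint_kernel {..<m} e l \<and> Cod C k = A \<and> Cod C l = B \<and>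
    \<phi> \<in> hom C (Dom C k) (Dom C l) \<and> is_regular_epi C \<phi> \<and> l \<cdot> \<phi> = f \<cdot> k"
    by (rule Suc.IH) (use Suc.prems in simp_all)
  then obtain k l \<phi> where k: "joint_kernel {..<m} d k" "Cod C k = A" and l: "joint_kernel {..<m} e l" "Cod C l = B"
    and \<phi>: "\<phi> \<in> hom C (Dom C k) (Dom C l)" "is_regular_epi C \<phi>" "l \<cdot> \<phi> = f \<cdot> k"
    by blast
  text \<open>The last idempotent commutes with the others, so it restricts to the joint kernel.\<close>
  have restrict: "\<exists>c. c \<in> hom C (Dom C h) (Dom C h) \<and> c \<cdot> c = c \<and> h \<cdot> c = b m \<cdot> h"
    if h: "joint_kernel {..<m} b h" "Cod C h = Y"
      and b: "\<And>i. i < Suc m \<Longrightarrow> b i \<in> hom C Y Y" "b m \<cdot> b m = b m"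
        "\<And>i. i < Suc m \<Longrightarrow> b i \<cdot> b m = b m \<cdot> b i"
    for b h Y
  proof -
    have H: "is_mono C h" "h \<in> Arr C" "\<And>j. j < m \<Longrightarrow> is_zero_mor C (b j \<cdot> h)"
      using h by (simp_all add: joint_kernel_def is_mono_def)
    have B: "b i \<in> Arr C" "Dom C (b i) = Y" "Cod C (b i) = Y" if "i < Suc m" for i
      using b(1)[OF that] by (simp_all add: hom_def)
    have Bm: "b m \<in> Arr C" "Dom C (b m) = Y" "Cod C (b m) = Y" using B by simp_all
    obtain c where c: "c \<in> Arr C" "Dom C c = Dom C h" "Cod C c = Dom C h" and hc: "h \<cdot> c = b m \<cdot> h"
    proof (rule joint_kernel_lift[OF h(1), of "b m \<cdot> h"])
      fix j assume "j \<in> {..<m}"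
      then have j: "j < m" "j < Suc m" by simp_all
      have "b j \<cdot> (b m \<cdot> h) = b m \<cdot> (b j \<cdot> h)"
        by (rule reassoc[OF b(3)]) (use B[OF j(2)] Bm h(2) H(2) j in simp_all)
      moreover have "is_zero_mor C (b m \<cdot> (b j \<cdot> h))"
        by (rule zero_mor_Comp_left[OF H(3)]) (use B[OF j(2)] Bm h(2) H(2) j in simp_all)
      ultimately show "is_zero_mor C (b j \<cdot> (b m \<cdot> h))" by simp
    qed (use Bm h(2) H(2) in simp_all)
    have "h \<cdot> (c \<cdot> c) = b m \<cdot> (h \<cdot> c)" by (rule reassoc[OF hc]) (use Bm h(2) H(2) c in simp_all)
    also have "\<dots> = b m \<cdot> h" unfolding hc by (rule reassoc1[OF b(2)]) (use Bm h(2) H(2) in simp_all)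
    finally have "h \<cdot> (c \<cdot> c) = h \<cdot> c" using hc by simp
    then have "c \<cdot> c = c"
      by (rule monoD[OF H(1), rotated -1]) (use c in simp_all)
    then show ?thesis using c hc by (auto simp: hom_def)
  qed
  obtain c where c: "c \<in> hom C (Dom C k) (Dom C k)" "c \<cdot> c = c" "k \<cdot> c = d m \<cdot> k"
    using restrict[OF k] Suc.prems by (metis less_Suc_eq)
  obtain c' where c': "c' \<in> hom C (Dom C l) (Dom C l)" "c' \<cdot> c' = c'" "l \<cdot> c' = e m \<cdot> l"
    using restrict[OF l] Suc.prems by (metis less_Suc_eq)
  have mono: "is_mono C k" "is_mono C l" using k l by (simp_all add: joint_kernel_def)
  have T: "k \<in> Arr C" "l \<in> Arr C" "f \<in> Arr C" "Dom C f = A" "Cod C f = B"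
    "\<phi> \<in> Arr C" "Dom C \<phi> = Dom C k" "Cod C \<phi> = Dom C l"
    "c \<in> Arr C" "Dom C c = Dom C k" "Cod C c = Dom C k"
    "c' \<in> Arr C" "Dom C c' = Dom C l" "Cod C c' = Dom C l"
    "d m \<in> Arr C" "Dom C (d m) = A" "Cod C (d m) = A" "e m \<in> Arr C" "Dom C (e m) = B" "Cod C (e m) = B"
    using mono \<phi>(1) c(1) c'(1) Suc.prems(1) Suc.prems(3)[of m] Suc.prems(6)[of m]
    by (simp_all add: is_mono_def hom_def)
  note T = T k(2) l(2)
  \<comment> \<open>\<open>\<phi>\<close> intertwines the restricted idempotents, as is seen after
    composing with the monic \<open>l\<close>.\<close>
  have eq: "\<phi> \<cdot> c = c' \<cdot> \<phi>"
  proof (rule monoD[OF mono(2)])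
    have "l \<cdot> (\<phi> \<cdot> c) = f \<cdot> (k \<cdot> c)" by (rule reassoc[OF \<phi>(3)]) (use T in simp_all)
    also have "\<dots> = e m \<cdot> (f \<cdot> k)" unfolding c(3) by (rule reassoc[OF Suc.prems(9)]) (use T in simp_all)
    also have "\<dots> = l \<cdot> (c' \<cdot> \<phi>)"
      unfolding \<phi>(3)[symmetric] by (rule reassoc[OF c'(3)[symmetric]]) (use T in simp_all)
    finally show "l \<cdot> (\<phi> \<cdot> c) = l \<cdot> (c' \<cdot> \<phi>)" .
  qed (use T in simp_all)
  \<comment> \<open>Being killed by every \<open>b i\<close> with \<open>i \<le> m\<close> means
    factoring through \<open>h\<close> by an arrow that the restriction \<open>a\<close> of
    \<open>b m\<close> kills.\<close>
  have compose: "joint_kernel {..<Suc m} b (h \<cdot> k')" "Cod C (h \<cdot> k') = Y" "k' \<in> Arr C" "Cod C k' = Dom C h"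
    "Dom C (h \<cdot> k') = Dom C k'"
    if h: "joint_kernel {..<m} b h" "Cod C h = Y"
      and b: "\<And>i. i < Suc m \<Longrightarrow> b i \<in> hom C Y Y"
      and a: "a \<in> hom C (Dom C h) (Dom C h)" "h \<cdot> a = b m \<cdot> h"
      and k': "is_kernel C a k'"
    for b h Y a k'
  proof -
    have H: "is_mono C h" "h \<in> Arr C" "\<And>j. j < m \<Longrightarrow> is_zero_mor C (b j \<cdot> h)"
      using h by (simp_all add: joint_kernel_def is_mono_def)
    have B: "b i \<in> Arr C" "Dom C (b i) = Y" "Cod C (b i) = Y" if "i < Suc m" for i
      using b(1)[OF that] by (simp_all add: hom_def)
    have Bm: "b m \<in> Arr C" "Dom C (b m) = Y" "Cod C (b m) = Y" using B by simp_all
    have A: "a \<in> Arr C" "Dom C a = Dom C h" "Cod C a = Dom C h" using a by (simp_all add: hom_def)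
    show K: "k' \<in> Arr C" "Cod C k' = Dom C h" using kernelD(2,3)[OF k'] A by simp_all
    note T = h(2) H(2) Bm A K
    show "Cod C (h \<cdot> k') = Y" "Dom C (h \<cdot> k') = Dom C k'" using T by simp_all
    show "joint_kernel {..<Suc m} b (h \<cdot> k')"
      unfolding joint_kernel_def
    proof (intro conjI ballI impI)
      show "is_mono C (h \<cdot> k')" by (rule mono_Comp[OF H(1) kernelD(5)[OF k'] K(2)])
      fix j assume "j \<in> {..<Suc m}"
      then have j: "j < Suc m" by simp
      have 1: "b j \<cdot> (h \<cdot> k') = b j \<cdot> h \<cdot> k'"
        by (rule assoc[symmetric]) (use T B[OF j] in simp_all)
      show "is_zero_mor C (b j \<cdot> (h \<cdot> k'))"
      proof (cases "j = m")
        case True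
        have "b m \<cdot> (h \<cdot> k') = h \<cdot> (a \<cdot> k')"
          by (rule reassoc[OF a(2)[symmetric]]) (use T in simp_all)
        moreover have "is_zero_mor C (h \<cdot> (a \<cdot> k'))"
          by (rule zero_mor_Comp_left[OF kernelD(4)[OF k']]) (use T in simp_all)
        ultimately show ?thesis using True by simp
      next
        case False
        then show ?thesis
          unfolding 1 using j by (intro zero_mor_Comp_right[OF H(3)]) (use T B[OF j] in simp_all)
      qed
    next
      fix x assume x': "x \<in> Arr C" "Cod C x = Cod C (h \<cdot> k') \<and> (\<forall>j\<in>{..<Suc m}. is_zero_mor C (b j \<cdot> x))"
      then have x: "x \<in> Arr C" "Cod C x = Y" "\<And>j. j < Suc m \<Longrightarrow> is_zero_mor C (b j \<cdot> x)"
        using T by simp_all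
      obtain u where u: "u \<in> Arr C" "Dom C u = Dom C x" "Cod C u = Dom C h" and hu: "h \<cdot> u = x"
        using joint_kernel_lift[OF h(1), of x] x T by auto
      have "h \<cdot> (a \<cdot> u) = b m \<cdot> x"
        unfolding hu[symmetric] by (rule reassoc[OF a(2)]) (use T u in simp_all)
      then have "is_zero_mor C (h \<cdot> (a \<cdot> u))" using x(3) by simp
      then have "is_zero_mor C (a \<cdot> u)"
        by (rule zero_mor_cancel_mono[OF H(1), rotated -1]) (use T u in simp_all)
      then obtain w where w: "w \<in> Arr C" "Dom C w = Dom C x" "Cod C w = Dom C k'" and kw: "k' \<cdot> w = u"
        using kernel_lift[OF k', of u] T u by auto
      have "h \<cdot> k' \<cdot> w = x" using assoc[of w k' h] kw hu w T by simp
      then show "\<exists>u\<in>hom C (Dom C x) (Dom C (h \<cdot> k')). h \<cdot> k' \<cdot> u = x"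
        using w T by (auto simp: hom_def)
    qed
  qed
  obtain k' where k': "is_kernel C c k'" using kernel_exists T(9) by blast
  obtain l' where l': "is_kernel C c' l'" using kernel_exists T(12) by blast
  have dm: "\<And>i. i < Suc m \<Longrightarrow> d i \<in> hom C A A" "\<And>i. i < Suc m \<Longrightarrow> e i \<in> hom C B B"
    using Suc.prems by simp_all
  note ck = compose[OF k dm(1) c(1,3) k'] and cl = compose[OF l dm(2) c'(1,3) l']
  have K: "is_zero_mor C (c \<cdot> k')" by (rule kernelD(4)[OF k'])
  note T = T ck(3,4) cl(3,4)
  have "c' \<cdot> (\<phi> \<cdot> k') = \<phi> \<cdot> (c \<cdot> k')" by (rule reassoc[OF eq[symmetric]]) (use T in simp_all)
  moreover have "is_zero_mor C (\<phi> \<cdot> (c \<cdot> k'))" by (rule zero_mor_Comp_left[OF K]) (use T in simp_all)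
  ultimately obtain \<psi> where \<psi>: "\<psi> \<in> Arr C" "Dom C \<psi> = Dom C k'" "Cod C \<psi> = Dom C l'" and lp: "l' \<cdot> \<psi> = \<phi> \<cdot> k'"
    using kernel_lift[OF l', of "\<phi> \<cdot> k'"] T by auto
  have re: "is_regular_epi C \<psi>"
    by (rule idempotent_kernel_regular_epi[OF \<phi>(1,2) c(1,2) c'(1,2) eq k' l' _ lp]) (use \<psi> in \<open>simp add: hom_def\<close>)
  have "l \<cdot> l' \<cdot> \<psi> = l \<cdot> (l' \<cdot> \<psi>)" by (rule assoc) (use T \<psi> in simp_all)
  also have "\<dots> = f \<cdot> (k \<cdot> k')" unfolding lp by (rule reassoc[OF \<phi>(3)]) (use T in simp_all)
  finally have "l \<cdot> l' \<cdot> \<psi> = f \<cdot> (k \<cdot> k')" .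
  then show ?case
    using ck(1,2,5) cl(1,2,5) \<psi> re
    by (intro exI[of _ "k \<cdot> k'"] exI[of _ "l \<cdot> l'"] exI[of _ \<psi>]) (simp add: hom_def)
qed

end

section \<open>Cokernels\<close>

context category
begin

lemma cokernelD:
  assumes "is_cokernel C f q"
  shows "f \<in> Arr C" "q \<in> Arr C" "Dom C q = Cod C f" "is_zero_mor C (q \<cdot> f)"
  using assms by (simp_all add: is_cokernel_def)

lemma cokernel_ex1:
  assumes "is_cokernel C f q" "h \<in> Arr C" "Dom C h = Cod C f" "is_zero_mor C (h \<cdot> f)"
  shows "\<exists>!u. u \<in> hom C (Cod C q) (Cod C h) \<and> u \<cdot> q = h"
proof -
  have "\<forall>A. \<forall>h\<in>hom C (Cod C f) A. is_zero_mor C (h \<cdot> f) \<longrightarrow>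
      (\<exists>!u. u \<in> hom C (Cod C q) A \<and> u \<cdot> q = h)"
    using assms(1) unfolding is_cokernel_def by (elim conjE)
  moreover have "h \<in> hom C (Cod C f) (Cod C h)" using assms by (simp add: hom_def)
  ultimately show ?thesis using assms(4) by simp
qed

lemma cokernel_cancel:
  assumes q: "is_cokernel C f q" and x: "x \<in> hom C (Cod C q) A" "y \<in> hom C (Cod C q) A" "x \<cdot> q = y \<cdot> q"
  shows "x = y"
proof -
  note Q = cokernelD[OF q]
  have X: "x \<in> Arr C" "Dom C x = Cod C q" "Cod C x = A" using x by (simp_all add: hom_def)
  have "is_zero_mor C (x \<cdot> (q \<cdot> f))"
    by (rule zero_mor_Comp_left[OF Q(4)]) (use X Q(1-3) in simp_all)
  moreover have "x \<cdot> q \<cdot> f = x \<cdot> (q \<cdot> f)" by (rule assoc) (use X Q(1-3) in simp_all)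
  ultimately have "\<exists>!u. u \<in> hom C (Cod C q) A \<and> u \<cdot> q = x \<cdot> q"
    using cokernel_ex1[OF q, of "x \<cdot> q"] X Q(1-3) by simp
  then show ?thesis using x by metis
qed

lemma cokernel_iso:
  assumes q: "is_cokernel C f q" and r: "is_cokernel C f r"
  obtains u where "u \<in> hom C (Cod C q) (Cod C r)" "u \<cdot> q = r" "is_iso C u"
proof -
  note Q = cokernelD[OF q] and R = cokernelD[OF r]
  obtain u where u: "u \<in> hom C (Cod C q) (Cod C r)" and uq: "u \<cdot> q = r"
    using cokernel_ex1[OF q R(2-4)] by blast
  obtain v where v: "v \<in> hom C (Cod C r) (Cod C q)" and vr: "v \<cdot> r = q"
    using cokernel_ex1[OF r Q(2-4)] by blast
  have T: "u \<in> Arr C" "Dom C u = Cod C q" "Cod C u = Cod C r" "v \<in> Arr C" "Dom C v = Cod C r" "Cod C v = Cod C q"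
    using u v by (simp_all add: hom_def)
  note T = T Q(2) R(2)
  have "v \<cdot> u = Ident C (Cod C q)"
  proof (rule cokernel_cancel[OF q])
    have "v \<cdot> u \<cdot> q = v \<cdot> (u \<cdot> q)" by (rule assoc) (use T in simp_all)
    then show "v \<cdot> u \<cdot> q = Ident C (Cod C q) \<cdot> q" using uq vr T by simp
  qed (use T in \<open>simp_all add: hom_def\<close>)
  moreover have "u \<cdot> v = Ident C (Cod C r)"
  proof (rule cokernel_cancel[OF r])
    have "u \<cdot> v \<cdot> r = u \<cdot> (v \<cdot> r)" by (rule assoc) (use T in simp_all)
    then show "u \<cdot> v \<cdot> r = Ident C (Cod C r) \<cdot> r" using uq vr T by simp
  qed (use T in \<open>simp_all add: hom_def\<close>)
  ultimately have "is_iso C u" by (intro isoI[of u v]) (use T in simp_all)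
  then show ?thesis using that u uq by blast
qed

end

text \<open>Only \<open>Obj\<close> and \<open>Arr\<close> change, so equations between composites
  read the same in both categories. Universal properties do not, because they range over the objects
  and arrows of the respective category.\<close>

lemma full_sub_simps [simp]:
  "Obj (full_sub C B) = B" "Dom (full_sub C B) = Dom C" "Cod (full_sub C B) = Cod C"
  "Ident (full_sub C B) = Ident C" "Comp (full_sub C B) = Comp C"
  "f \<in> Arr (full_sub C B) \<longleftrightarrow> f \<in> Arr C \<and> Dom C f \<in> B \<and> Cod C f \<in> B"
  by (simp_all add: full_sub_def)

lemma hom_full_sub: "hom (full_sub C B) D E = (if D \<in> B \<and> E \<in> B then hom C D E else {})"
  by (auto simp: hom_def)

subsection \<open>Birkhoff reflections\<close>

text \<open>\<open>is_reflector\<close> asserts that some unit exists; the locale fixes one.\<close>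

locale birkhoff_reflection = semi_abelian_category +
  fixes B :: "'a set" and F :: "('a, 'b, 'a, 'b) ftor" and \<eta> :: "'a \<Rightarrow> 'b"
  assumes birkhoff: "is_birkhoff C B"
    and functor_F: "is_functor C (full_sub C B) F"
    and unit: "nat_transf C C id_ftor F \<eta>"
    and unit_universal: "\<And>A D f. A \<in> Obj C \<Longrightarrow> D \<in> B \<Longrightarrow> f \<in> hom C A D \<Longrightarrow>
      \<exists>!g. g \<in> hom C (on_obj F A) D \<and> g \<cdot> \<eta> A = f"
begin

abbreviation \<B> where "\<B> \<equiv> full_sub C B"

lemma B_Obj: "D \<in> B \<Longrightarrow> D \<in> Obj C"
  using birkhoff by (auto simp: is_birkhoff_def)

lemma mono_in_B:
  assumes "is_mono C m" "Cod C m \<in> B"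
  shows "Dom C m \<in> B"
  using birkhoff assms by (simp add: is_birkhoff_def)

lemma F_Obj: "A \<in> Obj C \<Longrightarrow> on_obj F A \<in> B"
  using functor_F by (simp add: is_functor_def)

lemma unit_Arr:
  assumes "A \<in> Obj C"
  shows "\<eta> A \<in> Arr C" "Dom C (\<eta> A) = A" "Cod C (\<eta> A) = on_obj F A"
  using unit assms by (simp_all add: nat_transf_def hom_def id_ftor_def)

lemma unit_lift:
  assumes "A \<in> Obj C" "f \<in> Arr C" "Dom C f = A" "Cod C f \<in> B"
  obtains g where "g \<in> Arr C" "Dom C g = on_obj F A" "Cod C g = Cod C f" "g \<cdot> \<eta> A = f"
proof -
  have "f \<in> hom C A (Cod C f)" using assms by (simp add: hom_def)
  from unit_universal[OF assms(1,4) this] obtain g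
    where "g \<in> hom C (on_obj F A) (Cod C f)" "g \<cdot> \<eta> A = f" by blast
  then show ?thesis using that[of g] by (simp add: hom_def)
qed

lemma unit_cancel:
  assumes "A \<in> Obj C" "g \<in> hom C (on_obj F A) D" "h \<in> hom C (on_obj F A) D" "D \<in> B" "g \<cdot> \<eta> A = h \<cdot> \<eta> A"
  shows "g = h"
proof -
  have "g \<cdot> \<eta> A \<in> hom C A D" using assms unit_Arr by (simp add: hom_def)
  from unit_universal[OF assms(1,4) this] show ?thesis using assms by metis
qed

lemma category_\<B>: "category \<B>"
  using functor_F by (simp add: is_functor_def)

text \<open>The unit at a zero object is monic because its domain is terminal, so a zero object is a
  subobject of an object of \<open>B\<close>.\<close>

lemma zero_obj_in_B:
  assumes Z: "is_zero_obj C Z"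
  shows "Z \<in> B" "is_zero_obj \<B> Z"
proof -
  have O: "Z \<in> Obj C" using Z by (simp add: is_zero_obj_def is_initial_def)
  have "is_mono C (\<eta> Z)"
    unfolding is_mono_def
  proof (intro conjI ballI impI)
    fix f g assume "f \<in> Arr C" "g \<in> Arr C" "Dom C f = Dom C g \<and> Cod C f = Dom C (\<eta> Z) \<and>
      Cod C g = Dom C (\<eta> Z) \<and> \<eta> Z \<cdot> f = \<eta> Z \<cdot> g"
    then have "f \<in> hom C (Dom C g) Z" "g \<in> hom C (Dom C g) Z" "Dom C g \<in> Obj C"
      using unit_Arr[OF O] by (simp_all add: hom_def)
    then show "f = g" using Z unfolding is_zero_obj_def is_terminal_def by blast
  qed (rule unit_Arr(1)[OF O])
  then show "Z \<in> B" using mono_in_B[of "\<eta> Z"] unit_Arr[OF O] F_Obj[OF O] by simp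
  then show "is_zero_obj \<B> Z"
    using Z B_Obj by (simp add: is_zero_obj_def is_initial_def is_terminal_def hom_full_sub)
qed

lemma pointed_\<B>: "pointed \<B>"
  using pointed zero_obj_in_B by (auto simp: pointed_def)

end

text \<open>Joint kernels, summand killers and the cancellation of zero arrows were developed for
  pointed categories, so they become available in \<open>B\<close>; regular epimorphisms are
  constructed in the ambient category.\<close>

sublocale birkhoff_reflection \<subseteq> sub: pointed_category \<B>
  by (simp add: pointed_category_def pointed_category_axioms_def category_\<B> pointed_\<B>)

section \<open>Comparing zero arrows, coproducts, cosmash products and commutators of the two
  categories\<close>

context birkhoff_reflection
begin

text \<open>The zero object \<open>W\<close> is only given as one of \<open>B\<close>. Since it is
  initial there, the arrow \<open>b\<close> out of it coincides with the zero arrow of the ambient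
  category.\<close>

lemma zero_mor_\<B>:
  assumes "is_zero_mor \<B> f"
  shows "is_zero_mor C f"
proof -
  have "\<exists>W a b. is_zero_obj \<B> W \<and> a \<in> hom \<B> (Dom C f) W \<and> b \<in> hom \<B> W (Cod C f) \<and> f = b \<cdot> a"
    and f: "f \<in> Arr C"
    using assms by (simp_all add: is_zero_mor_def)
  then obtain W a b where W: "is_zero_obj \<B> W" and a: "a \<in> hom \<B> (Dom C f) W" and b: "b \<in> hom \<B> W (Cod C f)"
    and eq: "f = b \<cdot> a"
    by blast
  have WB: "W \<in> B" using W by (simp add: is_zero_obj_def is_initial_def)
  have A: "a \<in> Arr C" "Cod C a = W" using a by (simp_all add: hom_def)
  have Bb: "b \<in> Arr C" "Dom C b = W" "Cod C b \<in> B" using b by (auto simp: hom_def)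
  obtain z where z: "is_zero_mor C z" "z \<in> Arr C" "Dom C z = W" "Cod C z = Cod C b"
    using zero_mor_exists[OF B_Obj[OF WB] Cod_Obj[OF Bb(1)]] by metis
  have "z \<in> hom \<B> W (Cod C b)" "b \<in> hom \<B> W (Cod C b)" "Cod C b \<in> Obj \<B>"
    using z Bb WB by (simp_all add: hom_def)
  then have "z = b" using W unfolding is_zero_obj_def is_initial_def by blast
  then have "is_zero_mor C b" using z by simp
  then show ?thesis
    unfolding eq by (rule zero_mor_Comp_right) (use A Bb in simp_all)
qed

lemma zero_mor_\<B>_iff:
  assumes "f \<in> Arr C" "Dom C f \<in> B" "Cod C f \<in> B"
  shows "is_zero_mor \<B> f \<longleftrightarrow> is_zero_mor C f"
proof
  assume f: "is_zero_mor C f"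
  obtain z where z: "is_zero_mor \<B> z" "z \<in> Arr \<B>" "Dom \<B> z = Dom C f" "Cod \<B> z = Cod C f"
    using sub.zero_mor_exists[of "Dom C f" "Cod C f"] assms by auto
  have "f = z"
    by (rule zero_mor_unique[OF f zero_mor_\<B>]) (use z in simp_all)
  then show "is_zero_mor \<B> f" using z by simp
qed (rule zero_mor_\<B>)

text \<open>A monomorphism \<open>m\<close> into \<open>S'\<close> through which \<open>t\<close>
  factors has its domain in \<open>B\<close>. By the universal property of the unit, this domain
  receives each \<open>on_obj F (Y i)\<close>, and the coproduct of \<open>B\<close> turns these
  arrows into a right inverse of \<open>m\<close>.\<close>

lemma coproduct_comparison:
  assumes S: "is_coproduct C I Y S \<iota>" and S': "is_coproduct \<B> I (\<lambda>i. on_obj F (Y i)) S' \<iota>'"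
  obtains t where "t \<in> hom C S S'" "is_regular_epi C t" "\<And>i. i \<in> I \<Longrightarrow> t \<cdot> \<iota> i = \<iota>' i \<cdot> \<eta> (Y i)"
proof -
  have i: "\<iota> i \<in> Arr C" "Dom C (\<iota> i) = Y i" "Cod C (\<iota> i) = S" "Y i \<in> Obj C"
    "\<iota>' i \<in> Arr C" "Dom C (\<iota>' i) = on_obj F (Y i)" "Cod C (\<iota>' i) = S'" if "i \<in> I" for i
  proof -
    have "\<iota> i \<in> hom C (Y i) S" "\<iota>' i \<in> hom \<B> (on_obj F (Y i)) S'"
      using S S' that by (simp_all add: is_coproduct_def)
    then show "\<iota> i \<in> Arr C" "Dom C (\<iota> i) = Y i" "Cod C (\<iota> i) = S"
      "\<iota>' i \<in> Arr C" "Dom C (\<iota>' i) = on_obj F (Y i)" "Cod C (\<iota>' i) = S'"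
      by (simp_all add: hom_def)
    then show "Y i \<in> Obj C" using Dom_Obj[of "\<iota> i"] by simp
  qed
  have SB: "S' \<in> B" using S' by (simp add: is_coproduct_def)
  obtain t where t: "t \<in> hom C S S'" and ti: "\<And>i. i \<in> I \<Longrightarrow> t \<cdot> \<iota> i = \<iota>' i \<cdot> \<eta> (Y i)"
    using coproduct_lift[OF S B_Obj[OF SB], of "\<lambda>i. \<iota>' i \<cdot> \<eta> (Y i)"] i unit_Arr
    by (auto simp: hom_def)
  have T: "t \<in> Arr C" "Dom C t = S" "Cod C t = S'" using t by (simp_all add: hom_def)
  have "is_regular_epi C t"
  proof (rule regular_epiI[OF T(1)])
    fix m g assume m: "is_mono C m" "g \<in> Arr C" "Cod C g = Dom C m" and mg: "m \<cdot> g = t"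
    have M: "m \<in> Arr C" using m by (simp add: is_mono_def)
    have D: "Dom C g = S" "Cod C m = S'" using Comp_Arr(2,3)[of g m] m M mg T by simp_all
    have MB: "Dom C m \<in> B" using mono_in_B[OF m(1)] D SB by simp
    note T = m(2,3) M D
    have "\<exists>u. u \<in> hom C (on_obj F (Y i)) (Dom C m) \<and> u \<cdot> \<eta> (Y i) = g \<cdot> \<iota> i" if "i \<in> I" for i
      by (rule unit_lift[OF i(4)[OF that], of "g \<cdot> \<iota> i"]) (use T MB i[OF that] in \<open>auto simp: hom_def\<close>)
    then obtain u where u: "\<And>i. i \<in> I \<Longrightarrow> u i \<in> hom C (on_obj F (Y i)) (Dom C m)"
      "\<And>i. i \<in> I \<Longrightarrow> u i \<cdot> \<eta> (Y i) = g \<cdot> \<iota> i"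
      by metis
    obtain v where v: "v \<in> hom \<B> S' (Dom C m)" "\<And>i. i \<in> I \<Longrightarrow> v \<cdot> \<iota>' i = u i"
      using sub.coproduct_lift[OF S', of "Dom C m" u] MB u(1) i(4) F_Obj by (auto simp: hom_full_sub)
    have V: "v \<in> Arr C" "Dom C v = S'" "Cod C v = Dom C m" using v(1) by (simp_all add: hom_def)
    have "m \<cdot> v = Ident C S'"
    proof (rule sub.coproduct_eqI[OF S', of _ S', unfolded full_sub_simps])
      fix j assume j: "j \<in> I"
      note J = i[OF j] unit_Arr[OF i(4)[OF j]]
      have "m \<cdot> v \<cdot> \<iota>' j = m \<cdot> (v \<cdot> \<iota>' j)" by (rule assoc) (use T V J in simp_all)
      also have "\<dots> = m \<cdot> u j" using v(2)[OF j] by simp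
      finally have 1: "m \<cdot> v \<cdot> \<iota>' j = m \<cdot> u j" .
      have U: "u j \<in> Arr C" "Dom C (u j) = on_obj F (Y j)" "Cod C (u j) = Dom C m"
        using u(1)[OF j] by (simp_all add: hom_def)
      have "m \<cdot> u j = \<iota>' j"
      proof (rule unit_cancel[OF i(4)[OF j] _ _ SB])
        have "m \<cdot> u j \<cdot> \<eta> (Y j) = m \<cdot> (u j \<cdot> \<eta> (Y j))" by (rule assoc) (use T U J in simp_all)
        also have "\<dots> = t \<cdot> \<iota> j" unfolding u(2)[OF j] by (rule reassoc1[OF mg]) (use T J in simp_all)
        finally show "m \<cdot> u j \<cdot> \<eta> (Y j) = \<iota>' j \<cdot> \<eta> (Y j)" using ti[OF j] by simp
      qed (use T U J in \<open>simp_all add: hom_def\<close>)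
      then show "m \<cdot> v \<cdot> \<iota>' j = Ident C S' \<cdot> \<iota>' j" using 1 J by simp
    qed (use T V SB B_Obj[OF SB] in \<open>simp_all add: hom_def\<close>)
    then show "is_iso C m"
      by (intro mono_split_iso[OF m(1), of v]) (use T V in \<open>simp_all add: hom_def\<close>)
  qed
  then show ?thesis using that t ti by blast
qed

text \<open>\<open>k\<close> and \<open>k'\<close> are universal in different categories. They are
  matched with joint kernels \<open>k0\<close> and \<open>l0\<close>, both formed in the ambient
  category and linked by a regular epimorphism \<open>\<phi>\<close>; each of these passages
  preserves and reflects vanishing.\<close>

lemma cosmash_comparison:
  assumes c: "is_cosmash C m Y S \<iota> k" and c': "is_cosmash \<B> m (\<lambda>i. on_obj F (Y i)) S' \<iota>' k'"
    and t: "t \<in> hom C S S'" "is_regular_epi C t" "\<And>i. i < m \<Longrightarrow> t \<cdot> \<iota> i = \<iota>' i \<cdot> \<eta> (Y i)"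
    and g: "g \<in> Arr C" "Dom C g = S'" "Cod C g \<in> B"
  shows "is_zero_mor C (g \<cdot> k') \<longleftrightarrow> is_zero_mor C (g \<cdot> (t \<cdot> k))"
proof -
  have S: "is_coproduct C {..<m} Y S \<iota>" and S': "is_coproduct \<B> {..<m} (\<lambda>i. on_obj F (Y i)) S' \<iota>'"
    using c c' by (simp_all add: is_cosmash_def)
  have i: "\<iota> i \<in> Arr C" "Dom C (\<iota> i) = Y i" "Cod C (\<iota> i) = S" "Y i \<in> Obj C"
    "\<iota>' i \<in> Arr C" "Dom C (\<iota>' i) = on_obj F (Y i)" "Cod C (\<iota>' i) = S'" if "i < m" for i
  proof -
    have "\<iota> i \<in> hom C (Y i) S" "\<iota>' i \<in> hom \<B> (on_obj F (Y i)) S'"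
      using S S' that by (simp_all add: is_coproduct_def)
    then show "\<iota> i \<in> Arr C" "Dom C (\<iota> i) = Y i" "Cod C (\<iota> i) = S"
      "\<iota>' i \<in> Arr C" "Dom C (\<iota>' i) = on_obj F (Y i)" "Cod C (\<iota>' i) = S'"
      by (simp_all add: hom_def)
    then show "Y i \<in> Obj C" using Dom_Obj[of "\<iota> i"] by simp
  qed
  have SB: "S' \<in> B" using S' by (simp add: is_coproduct_def)
  obtain e where e: "summand_killers m S \<iota> e" and k: "joint_kernel {..<m} e k"
    using cosmash_joint_kernel[OF c] by metis
  obtain e' where e': "sub.summand_killers m S' \<iota>' e'" and k': "sub.joint_kernel {..<m} e' k'"
    using sub.cosmash_joint_kernel[OF c'] by metis
  have K: "k \<in> Arr C" "Cod C k = S" and K': "k' \<in> Arr C" "Cod C k' = S'" "Dom C k' \<in> B"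
    using c c' by (auto simp: is_cosmash_def is_kernel_def hom_def)
  have E: "e j \<in> hom C S S" "e' j \<in> hom C S' S'" "e j \<cdot> e j = e j" "e' j \<cdot> e' j = e' j" if "j < m" for j
    using e e' that SB summand_killers_Comp(1)[OF e S that] sub.summand_killers_Comp(1)[OF e' S' that]
    by (simp_all add: summand_killers_def sub.summand_killers_def hom_full_sub)
  have comm: "e i \<cdot> e j = e j \<cdot> e i" "e' i \<cdot> e' j = e' j \<cdot> e' i" if "i < m" "j < m" for i j
    using summand_killers_Comp(2)[OF e S that] sub.summand_killers_Comp(2)[OF e' S' that] by simp_all
  have T: "t \<in> Arr C" "Dom C t = S" "Cod C t = S'" using t by (simp_all add: hom_def)
  \<comment> \<open>On each summand both sides are zero, or both are the unit followed by
    \<open>\<iota>' l\<close>.\<close>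
  have te: "t \<cdot> e j = e' j \<cdot> t" if j: "j < m" for j
  proof (rule coproduct_eqI[OF S])
    have Ej: "e j \<in> Arr C" "Dom C (e j) = S" "Cod C (e j) = S" "e' j \<in> Arr C" "Dom C (e' j) = S'" "Cod C (e' j) = S'"
      using E[OF j] by (simp_all add: hom_def)
    then show "t \<cdot> e j \<in> hom C S S'" "e' j \<cdot> t \<in> hom C S S'" using T by (simp_all add: hom_def)
    fix l assume "l \<in> {..<m}"
    then have l: "l < m" by simp
    note X = i[OF l] unit_Arr[OF i(4)[OF l]] Ej T
    have 1: "t \<cdot> e j \<cdot> \<iota> l = t \<cdot> (e j \<cdot> \<iota> l)" "e' j \<cdot> t \<cdot> \<iota> l = e' j \<cdot> (t \<cdot> \<iota> l)"
      by (rule assoc, use X in simp_all)+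
    have 2: "e' j \<cdot> (t \<cdot> \<iota> l) = e' j \<cdot> \<iota>' l \<cdot> \<eta> (Y l)"
      unfolding t(3)[OF l] by (rule assoc[symmetric]) (use X in simp_all)
    have kill: "if l = j then is_zero_mor C (e j \<cdot> \<iota> l) else e j \<cdot> \<iota> l = \<iota> l"
      using e j l unfolding summand_killers_def by blast
    have kill': "if l = j then is_zero_mor \<B> (e' j \<cdot> \<iota>' l) else e' j \<cdot> \<iota>' l = \<iota>' l"
      using e' j l unfolding sub.summand_killers_def full_sub_simps by blast
    show "t \<cdot> e j \<cdot> \<iota> l = e' j \<cdot> t \<cdot> \<iota> l"
    proof (cases "l = j")
      case True
      have z: "is_zero_mor C (e j \<cdot> \<iota> l)" "is_zero_mor C (e' j \<cdot> \<iota>' l)"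
        using kill kill' True zero_mor_\<B> by simp_all
      have "is_zero_mor C (t \<cdot> (e j \<cdot> \<iota> l))"
        by (rule zero_mor_Comp_left[OF z(1)]) (use X in simp_all)
      moreover have "is_zero_mor C (e' j \<cdot> \<iota>' l \<cdot> \<eta> (Y l))"
        by (rule zero_mor_Comp_right[OF z(2)]) (use X in simp_all)
      ultimately show ?thesis
        unfolding 1 2 by (rule zero_mor_unique) (use X in simp_all)
    next
      case False
      then have "e j \<cdot> \<iota> l = \<iota> l" "e' j \<cdot> \<iota>' l = \<iota>' l"
        using kill kill' by simp_all
      then show ?thesis unfolding 1 2 using t(3)[OF l] by simp
    qed
  qed
  obtain k0 l0 \<phi> where k0: "joint_kernel {..<m} e k0" "Cod C k0 = S" and l0: "joint_kernel {..<m} e' l0" "Cod C l0 = S'"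
    and \<phi>: "\<phi> \<in> hom C (Dom C k0) (Dom C l0)" "is_regular_epi C \<phi>" and sq: "l0 \<cdot> \<phi> = t \<cdot> k0"
  proof -
    have "\<exists>k l \<phi>. joint_kernel {..<m} e k \<and> joint_kernel {..<m} e' l \<and> Cod C k = S \<and> Cod C l = S' \<and>
        \<phi> \<in> hom C (Dom C k) (Dom C l) \<and> is_regular_epi C \<phi> \<and> l \<cdot> \<phi> = t \<cdot> k"
      by (rule joint_kernel_regular_epi[OF t(1,2)]; (rule E comm te; assumption))
    then show ?thesis using that by blast
  qed
  have mono: "is_mono C k0" "is_mono C l0" using k0 l0 by (simp_all add: joint_kernel_def)
  \<comment> \<open>Closure under subobjects puts \<open>l0\<close> inside \<open>B\<close>, where
    \<open>k'\<close> is universal; so \<open>l0\<close> factors through \<open>k'\<close>.\<close>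
  have l0B: "Dom C l0 \<in> B" using mono_in_B[OF mono(2)] l0(2) SB by simp
  have X: "k0 \<in> Arr C" "l0 \<in> Arr C" "\<phi> \<in> Arr C" "Dom C \<phi> = Dom C k0" "Cod C \<phi> = Dom C l0"
    using mono \<phi>(1) by (simp_all add: is_mono_def hom_def)
  note X = X k0(2) l0(2) T K K'(1,2) g(1,2)
  obtain w where w: "w \<in> Arr C" "Dom C w = Dom C k" "Cod C w = Dom C k0" and kw: "k0 \<cdot> w = k"
    using joint_kernel_lift[OF k0(1), of k] k X by (auto simp: joint_kernel_def)
  obtain v where v: "v \<in> Arr C" "Dom C v = Dom C k0" "Cod C v = Dom C k" and kv: "k \<cdot> v = k0"
    using joint_kernel_lift[OF k, of k0] k0 X by (auto simp: joint_kernel_def)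
  obtain w' where w': "w' \<in> Arr C" "Dom C w' = Dom C k'" "Cod C w' = Dom C l0" and lw: "l0 \<cdot> w' = k'"
    using joint_kernel_lift[OF l0(1), of k'] k' X by (auto simp: sub.joint_kernel_def intro: zero_mor_\<B>)
  obtain v' where v': "v' \<in> Arr C" "Dom C v' = Dom C l0" "Cod C v' = Dom C k'" and kv': "k' \<cdot> v' = l0"
  proof (rule sub.joint_kernel_lift[OF k', of l0, unfolded full_sub_simps])
    fix j assume "j \<in> {..<m}"
    then have j: "j < m" by simp
    have "is_zero_mor C (e' j \<cdot> l0)" using l0(1) j by (simp add: joint_kernel_def)
    then show "is_zero_mor \<B> (e' j \<cdot> l0)"
      using zero_mor_\<B>_iff[of "e' j \<cdot> l0"] E(2)[OF j] X l0B SB by (simp add: hom_def)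
  next
    fix u assume "u \<in> Arr C \<and> Dom C u \<in> B \<and> Cod C u \<in> B" "Dom C u = Dom C l0" "Cod C u = Dom C k'" "k' \<cdot> u = l0"
    then show thesis using that[of u] by simp
  qed (use X l0B SB in simp_all)
  show ?thesis
  proof
    assume z: "is_zero_mor C (g \<cdot> k')"
    have "t \<cdot> k = l0 \<cdot> (\<phi> \<cdot> w)"
      unfolding kw[symmetric] by (rule reassoc[OF sq[symmetric]]) (use X w in simp_all)
    also have "\<dots> = k' \<cdot> (v' \<cdot> (\<phi> \<cdot> w))"
      by (rule reassoc1[OF kv', symmetric]) (use X w v' in simp_all)
    finally have "g \<cdot> (t \<cdot> k) = g \<cdot> k' \<cdot> (v' \<cdot> (\<phi> \<cdot> w))"
      using X w v' by (simp add: assoc)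
    moreover have "is_zero_mor C (g \<cdot> k' \<cdot> (v' \<cdot> (\<phi> \<cdot> w)))"
      by (rule zero_mor_Comp_right[OF z]) (use X w v' in simp_all)
    ultimately show "is_zero_mor C (g \<cdot> (t \<cdot> k))" by simp
  next
    assume z: "is_zero_mor C (g \<cdot> (t \<cdot> k))"
    \<comment> \<open>Restricting along \<open>v\<close> replaces \<open>k\<close> by
      \<open>k0\<close>; then \<open>\<phi>\<close> cancels, leaving \<open>l0\<close>, through
      which \<open>k'\<close> factors.\<close>
    have "is_zero_mor C (g \<cdot> (t \<cdot> k) \<cdot> v)"
      by (rule zero_mor_Comp_right[OF z]) (use X v in simp_all)
    moreover have "g \<cdot> (t \<cdot> k) \<cdot> v = g \<cdot> (t \<cdot> (k \<cdot> v))" using X v by (simp add: assoc)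
    moreover have "g \<cdot> (t \<cdot> (k \<cdot> v)) = g \<cdot> l0 \<cdot> \<phi>"
      unfolding kv sq[symmetric] by (rule assoc[symmetric]) (use X in simp_all)
    ultimately have "is_zero_mor C (g \<cdot> l0 \<cdot> \<phi>)" by simp
    then have "is_zero_mor C (g \<cdot> l0)"
      by (rule zero_mor_cancel_regular_epi[OF \<phi>(2), rotated -1]) (use X in simp_all)
    then have "is_zero_mor C (g \<cdot> l0 \<cdot> w')"
      by (rule zero_mor_Comp_right) (use X w' in simp_all)
    moreover have "g \<cdot> l0 \<cdot> w' = g \<cdot> (l0 \<cdot> w')" by (rule assoc) (use X w' in simp_all)
    ultimately show "is_zero_mor C (g \<cdot> k')" using lw by simp
  qed
qed

text \<open>A commutator is an image, and the regular epimorphism in front of it can be cancelled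
  from a zero test. So cosmash inclusions followed by codiagonals may be tested instead, and
  \<open>cosmash_comparison\<close> applies to \<open>h \<cdot> d'\<close>.\<close>

lemma commutator_comparison:
  assumes A: "A \<in> Obj C" and c: "is_commutator C m A c" and c': "is_commutator \<B> m (on_obj F A) c'"
    and h: "h \<in> Arr C" "Dom C h = on_obj F A" "Cod C h \<in> B"
  shows "is_zero_mor C (h \<cdot> c') \<longleftrightarrow> is_zero_mor C (h \<cdot> (\<eta> A \<cdot> c))"
proof -
  obtain S \<iota> k d where co: "is_cosmash C m (\<lambda>_. A) S \<iota> k" and d: "d \<in> hom C S A"
    "\<And>i. i < m \<Longrightarrow> d \<cdot> \<iota> i = Ident C A" and im: "is_image C (d \<cdot> k) c"
    using c unfolding is_commutator_def by blast
  obtain S' \<iota>' k' d' where co': "is_cosmash \<B> m (\<lambda>_. on_obj F A) S' \<iota>' k'" and d': "d' \<in> hom \<B> S' (on_obj F A)"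
    "\<And>i. i < m \<Longrightarrow> d' \<cdot> \<iota>' i = Ident C (on_obj F A)" and im': "is_image \<B> (d' \<cdot> k') c'"
    using c' unfolding is_commutator_def full_sub_simps by blast
  have S: "is_coproduct C {..<m} (\<lambda>_. A) S \<iota>" and S': "is_coproduct \<B> {..<m} (\<lambda>i. on_obj F A) S' \<iota>'"
    using co co' by (simp_all add: is_cosmash_def)
  have i: "\<iota> i \<in> Arr C" "Dom C (\<iota> i) = A" "Cod C (\<iota> i) = S"
    "\<iota>' i \<in> Arr C" "Dom C (\<iota>' i) = on_obj F A" "Cod C (\<iota>' i) = S'" if "i < m" for i
    using S S' that by (auto simp: is_coproduct_def hom_def)
  obtain t where t: "t \<in> hom C S S'" "is_regular_epi C t" "\<And>i. i < m \<Longrightarrow> t \<cdot> \<iota> i = \<iota>' i \<cdot> \<eta> A"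
    using coproduct_comparison[OF S S'] by auto
  have K: "k \<in> Arr C" "Cod C k = S" "k' \<in> Arr C" "Cod C k' = S'" "Dom C k' \<in> B"
    using co co' by (auto simp: is_cosmash_def is_kernel_def hom_def)
  have X: "d \<in> Arr C" "Dom C d = S" "Cod C d = A" "d' \<in> Arr C" "Dom C d' = S'" "Cod C d' = on_obj F A"
    "t \<in> Arr C" "Dom C t = S" "Cod C t = S'"
    using d(1) d'(1) t(1) by (simp_all add: hom_def)
  note X = X K(1-4) h(1,2) unit_Arr[OF A]
  \<comment> \<open>Both sides restrict to \<open>\<eta> A\<close> on every summand.\<close>
  have dt: "d' \<cdot> t = \<eta> A \<cdot> d"
  proof (rule coproduct_eqI[OF S])
    fix j assume "j \<in> {..<m}"
    then have j: "j < m" by simp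
    have "d' \<cdot> t \<cdot> \<iota> j = d' \<cdot> (t \<cdot> \<iota> j)" by (rule assoc) (use X i[OF j] in simp_all)
    also have "\<dots> = Ident C (on_obj F A) \<cdot> \<eta> A"
      unfolding t(3)[OF j] by (rule reassoc1[OF d'(2)[OF j]]) (use X i[OF j] in simp_all)
    also have "\<dots> = \<eta> A \<cdot> (d \<cdot> \<iota> j)" using d(2)[OF j] X by simp
    also have "\<dots> = \<eta> A \<cdot> d \<cdot> \<iota> j" by (rule assoc[symmetric]) (use X i[OF j] in simp_all)
    finally show "d' \<cdot> t \<cdot> \<iota> j = \<eta> A \<cdot> d \<cdot> \<iota> j" .
  qed (use X in \<open>simp_all add: hom_def\<close>)
  obtain e where e: "is_mono C c" "is_regular_epi C e" "Cod C e = Dom C c" and dk: "d \<cdot> k = c \<cdot> e"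
    using im by (auto simp: is_image_def)
  obtain e' where e': "is_mono \<B> c'" "is_regular_epi \<B> e'" "Cod C e' = Dom C c'" and dk': "d' \<cdot> k' = c' \<cdot> e'"
    using im' by (auto simp: is_image_def)
  have Y: "c \<in> Arr C" "e \<in> Arr C" "c' \<in> Arr C" "e' \<in> Arr C"
    and YB: "Dom C c' \<in> B" "Cod C c' \<in> B" "Dom C e' \<in> B" "Cod C e' \<in> B"
    using e e' regular_epi_Arr sub.regular_epi_Arr by (auto simp: is_mono_def)
  \<comment> \<open>\<open>is_commutator\<close> does not record this codomain; the image
    factorization does.\<close>
  have cod: "Cod C c = A" "Cod C c' = on_obj F A"
    using Comp_Arr(3)[of e c] Comp_Arr(3)[of k d] Comp_Arr(3)[of e' c'] Comp_Arr(3)[of k' d'] X Y e(3) e'(3) dk dk'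
    by simp_all
  note X = X Y cod e(3) e'(3)
  have "is_zero_mor C (h \<cdot> c') \<longleftrightarrow> is_zero_mor C (h \<cdot> c' \<cdot> e')"
  proof
    assume "is_zero_mor C (h \<cdot> c' \<cdot> e')"
    \<comment> \<open>\<open>e'\<close> is given as a regular epimorphism of \<open>B\<close>, so
      the cancellation takes place there.\<close>
    then have "is_zero_mor \<B> (h \<cdot> c' \<cdot> e')"
      by (subst zero_mor_\<B>_iff) (use X YB h(3) in simp_all)
    then have "is_zero_mor \<B> (h \<cdot> c')"
      by (rule sub.zero_mor_cancel_regular_epi[OF e'(2), unfolded full_sub_simps, rotated -1])
        (use X YB h(3) in simp_all)
    then show "is_zero_mor C (h \<cdot> c')" by (rule zero_mor_\<B>)
  qed (rule zero_mor_Comp_right, use X in simp_all)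
  also have "h \<cdot> c' \<cdot> e' = h \<cdot> d' \<cdot> k'"
    using dk' assoc[of e' c' h] assoc[of k' d' h] X by simp
  also have "is_zero_mor C (h \<cdot> d' \<cdot> k') \<longleftrightarrow> is_zero_mor C (h \<cdot> d' \<cdot> (t \<cdot> k))"
    by (rule cosmash_comparison[OF co co' t]) (use X h(3) in simp_all)
  also have "h \<cdot> d' \<cdot> (t \<cdot> k) = h \<cdot> (\<eta> A \<cdot> c) \<cdot> e"
  proof -
    have "h \<cdot> d' \<cdot> (t \<cdot> k) = h \<cdot> (d' \<cdot> (t \<cdot> k))" by (rule assoc) (use X in simp_all)
    also have "d' \<cdot> (t \<cdot> k) = \<eta> A \<cdot> (d \<cdot> k)" by (rule reassoc[OF dt]) (use X in simp_all)
    also have "h \<cdot> (\<eta> A \<cdot> (d \<cdot> k)) = h \<cdot> (\<eta> A \<cdot> c) \<cdot> e"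
      unfolding dk using X by (simp add: assoc)
    finally show ?thesis .
  qed
  also have "is_zero_mor C (h \<cdot> (\<eta> A \<cdot> c) \<cdot> e) \<longleftrightarrow> is_zero_mor C (h \<cdot> (\<eta> A \<cdot> c))"
  proof
    assume "is_zero_mor C (h \<cdot> (\<eta> A \<cdot> c) \<cdot> e)"
    then show "is_zero_mor C (h \<cdot> (\<eta> A \<cdot> c))"
      by (rule zero_mor_cancel_regular_epi[OF e(2), rotated -1]) (use X in simp_all)
  qed (rule zero_mor_Comp_right, use X in simp_all)
  finally show ?thesis .
qed

lemma F_Arr:
  assumes "f \<in> Arr C"
  shows "on_arr F f \<in> Arr C" "Dom C (on_arr F f) = on_obj F (Dom C f)" "Cod C (on_arr F f) = on_obj F (Cod C f)"
proof -
  have "f \<in> hom C (Dom C f) (Cod C f)" using assms by (simp add: hom_def)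
  then have "on_arr F f \<in> hom \<B> (on_obj F (Dom C f)) (on_obj F (Cod C f))"
    using functor_F unfolding is_functor_def by blast
  then show "on_arr F f \<in> Arr C" "Dom C (on_arr F f) = on_obj F (Dom C f)" "Cod C (on_arr F f) = on_obj F (Cod C f)"
    by (simp_all add: hom_def)
qed

lemma unit_natural:
  assumes "f \<in> Arr C"
  shows "on_arr F f \<cdot> \<eta> (Dom C f) = \<eta> (Cod C f) \<cdot> f"
proof -
  have "f \<in> hom C (Dom C f) (Cod C f)" using assms by (simp add: hom_def)
  then show ?thesis using unit by (simp add: nat_transf_def id_ftor_def)
qed

text \<open>For \<open>h\<close> into an object of \<open>B\<close>: \<open>h\<close> kills
  \<open>c'\<close> exactly when \<open>h \<cdot> \<eta> A\<close> kills \<open>c\<close>, that is,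
  factors through \<open>\<nu>\<close>; by adjunction this amounts to \<open>h\<close> factoring
  through \<open>on_arr F \<nu>\<close>.\<close>

lemma F_cokernel_commutator:
  assumes A: "A \<in> Obj C" and c: "is_commutator C m A c" and c': "is_commutator \<B> m (on_obj F A) c'"
    and \<nu>: "is_cokernel C c \<nu>" and dom: "Dom C \<nu> = A" and C': "c' \<in> Arr \<B>" "Cod C c' = on_obj F A"
  shows "is_cokernel \<B> c' (on_arr F \<nu>)"
proof -
  note N = cokernelD[OF \<nu>]
  let ?N = "Cod C \<nu>"
  have O: "?N \<in> Obj C" using N by simp
  note FN = F_Arr[OF N(2)]
  have C: "c' \<in> Arr C" "Dom C c' \<in> B" using C' by simp_all
  have nat: "on_arr F \<nu> \<cdot> \<eta> A = \<eta> ?N \<cdot> \<nu>" using unit_natural[OF N(2)] dom by simp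
  have cA: "Cod C c = A" using N(3) dom by simp
  note X = N(1,2) cA dom FN C(1) C'(2) unit_Arr[OF A] unit_Arr[OF O]
  show ?thesis
    unfolding is_cokernel_def full_sub_simps
  proof (intro conjI allI ballI impI)
    have "on_arr F \<nu> \<cdot> (\<eta> A \<cdot> c) = \<eta> ?N \<cdot> (\<nu> \<cdot> c)"
      by (rule reassoc[OF nat]) (use X in simp_all)
    moreover have "is_zero_mor C (\<eta> ?N \<cdot> (\<nu> \<cdot> c))"
      by (rule zero_mor_Comp_left[OF N(4)]) (use X in simp_all)
    ultimately have "is_zero_mor C (on_arr F \<nu> \<cdot> c')"
      using commutator_comparison[OF A c c', of "on_arr F \<nu>"] X F_Obj[OF O] by simp
    then show "is_zero_mor \<B> (on_arr F \<nu> \<cdot> c')"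
      by (subst zero_mor_\<B>_iff) (use X C F_Obj[OF O] in simp_all)
    fix D h assume h: "h \<in> hom \<B> (Cod C c') D" "is_zero_mor \<B> (h \<cdot> c')"
    then have H: "h \<in> Arr C" "Dom C h = on_obj F A" "Cod C h = D" "D \<in> B"
      using C'(2) by (auto simp: hom_def)
    have "is_zero_mor C (h \<cdot> (\<eta> A \<cdot> c))"
      using zero_mor_\<B>[OF h(2)] commutator_comparison[OF A c c', of h] H by simp
    moreover have "h \<cdot> \<eta> A \<cdot> c = h \<cdot> (\<eta> A \<cdot> c)" by (rule assoc) (use X H in simp_all)
    ultimately have "\<exists>!u. u \<in> hom C ?N D \<and> u \<cdot> \<nu> = h \<cdot> \<eta> A"
      using cokernel_ex1[OF \<nu>, of "h \<cdot> \<eta> A"] X H by simp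
    then obtain u where u: "u \<in> hom C ?N D" and un: "u \<cdot> \<nu> = h \<cdot> \<eta> A" by blast
    have U: "u \<in> Arr C" "Dom C u = ?N" "Cod C u = D" using u by (simp_all add: hom_def)
    obtain v where v: "v \<in> Arr C" "Dom C v = on_obj F ?N" "Cod C v = D" and vu: "v \<cdot> \<eta> ?N = u"
      by (rule unit_lift[OF O U(1,2)]) (use U H in simp_all)
    \<comment> \<open>Naturality of the unit translates factorizations through
      \<open>on_arr F \<nu>\<close> into factorizations through \<open>\<nu>\<close>, for existence
      and for uniqueness.\<close>
    have eta: "x \<cdot> on_arr F \<nu> \<cdot> \<eta> A = x \<cdot> \<eta> ?N \<cdot> \<nu>" if x: "x \<in> Arr C" "Dom C x = on_obj F ?N" for x
    proof -
      have "x \<cdot> on_arr F \<nu> \<cdot> \<eta> A = x \<cdot> (on_arr F \<nu> \<cdot> \<eta> A)" by (rule assoc) (use X x in simp_all)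
      also have "\<dots> = x \<cdot> \<eta> ?N \<cdot> \<nu>" unfolding nat by (rule assoc[symmetric]) (use X x in simp_all)
      finally show ?thesis .
    qed
    have "v \<cdot> on_arr F \<nu> = h"
      by (rule unit_cancel[OF A _ _ H(4)]) (use eta[OF v(1,2)] un vu X v H in \<open>simp_all add: hom_def\<close>)
    show "\<exists>!u. u \<in> hom \<B> (Cod C (on_arr F \<nu>)) D \<and> u \<cdot> on_arr F \<nu> = h"
    proof (rule ex1I[of _ v])
      show "v \<in> hom \<B> (Cod C (on_arr F \<nu>)) D \<and> v \<cdot> on_arr F \<nu> = h"
        using \<open>v \<cdot> on_arr F \<nu> = h\<close> v X H F_Obj[OF O] by (simp add: hom_def)
      fix w assume w: "w \<in> hom \<B> (Cod C (on_arr F \<nu>)) D \<and> w \<cdot> on_arr F \<nu> = h"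
      then have W: "w \<in> Arr C" "Dom C w = on_obj F ?N" "Cod C w = D" using X by (simp_all add: hom_def)
      have "w \<cdot> \<eta> ?N \<cdot> \<nu> = v \<cdot> \<eta> ?N \<cdot> \<nu>"
        using eta[OF W(1,2)] eta[OF v(1,2)] w \<open>v \<cdot> on_arr F \<nu> = h\<close> by simp
      then have "w \<cdot> \<eta> ?N = v \<cdot> \<eta> ?N"
        by (rule cokernel_cancel[OF \<nu>, rotated -1, where A = D]) (use X W v in \<open>simp_all add: hom_def\<close>)
      then show "w = v"
        by (rule unit_cancel[OF O, rotated -1, where D = D]) (use W v H in \<open>simp_all add: hom_def\<close>)
    qed
  qed (use X C C' F_Obj[OF A] F_Obj[OF O] in simp_all)
qed

end

section \<open>The natural isomorphism\<close>

lemma is_functor_comp: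
  assumes "is_functor C D F" "is_functor D E G"
  shows "is_functor C E (G \<circ>\<^sub>F F)"
proof -
  interpret C: category C using assms by (simp add: is_functor_def)
  have arr: "on_arr F f \<in> hom D (on_obj F A) (on_obj F A')" if "f \<in> hom C A A'" for f A A'
    using assms(1) that by (simp add: is_functor_def)
  show ?thesis
    unfolding is_functor_def comp_ftor_def ftor.select_convs comp_apply
  proof (intro conjI ballI allI impI)
    fix f g assume fg: "f \<in> Arr C" "g \<in> Arr C" "Cod C f = Dom C g"
    then have "on_arr F f \<in> Arr D" "on_arr F g \<in> Arr D" "Cod D (on_arr F f) = Dom D (on_arr F g)"
      using arr[of f "Dom C f" "Cod C f"] arr[of g "Dom C g" "Cod C g"] by (simp_all add: hom_def)
    then show "on_arr G (on_arr F (g \<cdot>\<^bsub>C\<^esub> f)) = on_arr G (on_arr F g) \<cdot>\<^bsub>E\<^esub> on_arr G (on_arr F f)"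
      using assms fg by (simp add: is_functor_def)
  qed (use assms in \<open>simp_all add: is_functor_def\<close>)
qed

theorem theorem3p7:
  fixes X :: "('o, 'm) cat" and B :: "'o set" and n :: nat
    and F N\<^sub>X N\<^sub>B :: "('o, 'm, 'o, 'm) ftor" and \<nu>\<^sub>X \<nu>\<^sub>B :: "'o \<Rightarrow> 'm"
  assumes "semi_abelian X"
    and "n \<ge> 1"
    and "is_birkhoff X B"
    and "is_reflector X B F"
    and "is_nil_reflection X n N\<^sub>X \<nu>\<^sub>X"
    and "is_nil_reflection (full_sub X B) n N\<^sub>B \<nu>\<^sub>B"
  shows "\<exists>\<alpha>. nat_iso X (full_sub X B) (N\<^sub>B \<circ>\<^sub>F F) (F \<circ>\<^sub>F N\<^sub>X) \<alpha> \<and>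
           (\<forall>A\<in>Obj X. \<alpha> A \<cdot>\<^bsub>full_sub X B\<^esub> \<nu>\<^sub>B (on_obj F A) = on_arr F (\<nu>\<^sub>X A))"
proof -
  have refl: "is_functor X (full_sub X B) F" "\<exists>\<eta>. nat_transf X X id_ftor F \<eta> \<and>
        (\<forall>A\<in>Obj X. \<forall>D\<in>B. \<forall>f\<in>hom X A D. \<exists>!g. g \<in> hom X (on_obj F A) D \<and> g \<cdot>\<^bsub>X\<^esub> \<eta> A = f)"
    using assms(4) by (simp_all add: is_reflector_def)
  then obtain \<eta> where \<eta>: "nat_transf X X id_ftor F \<eta>"
    "\<forall>A\<in>Obj X. \<forall>D\<in>B. \<forall>f\<in>hom X A D. \<exists>!g. g \<in> hom X (on_obj F A) D \<and> g \<cdot>\<^bsub>X\<^esub> \<eta> A = f"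
    by blast
  have cat: "category X" using assms(1) by (simp add: semi_abelian_def)
  interpret birkhoff_reflection X B F \<eta>
    by (intro birkhoff_reflection.intro semi_abelian_category.intro semi_abelian_category_axioms.intro
        birkhoff_reflection_axioms.intro cat assms(1,3) refl(1) \<eta>(1)) (use \<eta>(2) in blast)
  have NX: "is_functor X (full_sub X (nilpotent_objects X n)) N\<^sub>X" "nat_transf X X id_ftor N\<^sub>X \<nu>\<^sub>X"
    "\<And>A. A \<in> Obj X \<Longrightarrow> \<exists>c. is_commutator X (n + 1) A c \<and> is_cokernel X c (\<nu>\<^sub>X A)"
    using assms(5) by (simp_all add: is_nil_reflection_def)
  have NB: "is_functor \<B> (full_sub \<B> (nilpotent_objects \<B> n)) N\<^sub>B" "nat_transf \<B> \<B> id_ftor N\<^sub>B \<nu>\<^sub>B"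
    "\<And>A. A \<in> B \<Longrightarrow> \<exists>c. is_commutator \<B> (n + 1) A c \<and> is_cokernel \<B> c (\<nu>\<^sub>B A)"
    using assms(6) by (simp_all add: is_nil_reflection_def)
  have nuX: "\<nu>\<^sub>X A \<in> Arr X" "Dom X (\<nu>\<^sub>X A) = A" "Cod X (\<nu>\<^sub>X A) = on_obj N\<^sub>X A" if "A \<in> Obj X" for A
    using NX(2) that by (simp_all add: nat_transf_def id_ftor_def hom_def)
  have nuB: "\<nu>\<^sub>B A \<in> Arr \<B>" "Dom X (\<nu>\<^sub>B A) = A" "Cod X (\<nu>\<^sub>B A) = on_obj N\<^sub>B A" if "A \<in> B" for A
    using NB(2) that by (auto simp: nat_transf_def id_ftor_def hom_def)
  \<comment> \<open>The commutator is the one that comes with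
    \<open>\<nu>\<^sub>B (on_obj F A)\<close>, so two cokernels of one and the same arrow are
    compared.\<close>
  have coker: "\<exists>c. is_cokernel \<B> c (\<nu>\<^sub>B (on_obj F A)) \<and> is_cokernel \<B> c (on_arr F (\<nu>\<^sub>X A))"
    if A: "A \<in> Obj X" for A
  proof -
    obtain c where c: "is_commutator X (n + 1) A c" "is_cokernel X c (\<nu>\<^sub>X A)" using NX(3)[OF A] by blast
    obtain c' where c': "is_commutator \<B> (n + 1) (on_obj F A) c'" "is_cokernel \<B> c' (\<nu>\<^sub>B (on_obj F A))"
      using NB(3)[OF F_Obj[OF A]] by blast
    have "c' \<in> Arr \<B>" "Cod X c' = on_obj F A"
      using sub.cokernelD[OF c'(2)] nuB(2)[OF F_Obj[OF A]] by simp_all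
    then show ?thesis
      using F_cokernel_commutator[OF A c(1) c'(1) c(2) nuX(2)[OF A]] c'(2) by blast
  qed
  have "\<exists>u. u \<in> hom \<B> (on_obj N\<^sub>B (on_obj F A)) (on_obj F (on_obj N\<^sub>X A)) \<and>
      u \<cdot>\<^bsub>X\<^esub> \<nu>\<^sub>B (on_obj F A) = on_arr F (\<nu>\<^sub>X A) \<and> is_iso \<B> u" if A: "A \<in> Obj X" for A
  proof -
    obtain c where c: "is_cokernel \<B> c (\<nu>\<^sub>B (on_obj F A))" "is_cokernel \<B> c (on_arr F (\<nu>\<^sub>X A))"
      using coker[OF A] by blast
    show ?thesis
      by (rule sub.cokernel_iso[OF c])
        (use nuB(3)[OF F_Obj[OF A]] F_Arr(3)[OF nuX(1)[OF A]] nuX(3)[OF A] in auto)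
  qed
  then obtain \<alpha> where \<alpha>: "\<And>A. A \<in> Obj X \<Longrightarrow> \<alpha> A \<in> hom \<B> (on_obj N\<^sub>B (on_obj F A)) (on_obj F (on_obj N\<^sub>X A))"
    "\<And>A. A \<in> Obj X \<Longrightarrow> \<alpha> A \<cdot>\<^bsub>X\<^esub> \<nu>\<^sub>B (on_obj F A) = on_arr F (\<nu>\<^sub>X A)"
    "\<And>A. A \<in> Obj X \<Longrightarrow> is_iso \<B> (\<alpha> A)"
    by metis
  \<comment> \<open>The composites in the statement need endofunctors; the naturality of the
    reflection units supplies this typing.\<close>
  have functor_NX: "is_functor X X N\<^sub>X"
    using NX(2) by (simp add: nat_transf_def)
  have functor_NB: "is_functor \<B> \<B> N\<^sub>B"
    using NB(2) by (simp add: nat_transf_def)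
  \<comment> \<open>The components of \<open>\<alpha>\<close> were chosen object by object. Both
    sides agree after composition with \<open>\<nu>\<^sub>B (on_obj F A)\<close>, by naturality of
    the two units, and this arrow cancels because it is a cokernel.\<close>
  have natural: "on_arr F (on_arr N\<^sub>X f) \<cdot>\<^bsub>X\<^esub> \<alpha> A = \<alpha> A' \<cdot>\<^bsub>X\<^esub> on_arr N\<^sub>B (on_arr F f)"
    if f: "f \<in> hom X A A'" for A A' f
  proof -
    have f': "f \<in> Arr X" "Dom X f = A" "Cod X f = A'" using f by (simp_all add: hom_def)
    then have O: "A \<in> Obj X" "A' \<in> Obj X" using Dom_Obj[of f] Cod_Obj[of f] by simp_all
    have "on_arr N\<^sub>X f \<in> hom X (on_obj N\<^sub>X A) (on_obj N\<^sub>X A')"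
      using functor_NX f by (simp add: is_functor_def)
    then have Nf: "on_arr N\<^sub>X f \<in> Arr X" "Dom X (on_arr N\<^sub>X f) = on_obj N\<^sub>X A" "Cod X (on_arr N\<^sub>X f) = on_obj N\<^sub>X A'"
      by (simp_all add: hom_def)
    note Ff = F_Arr[OF f'(1), unfolded f'(2,3)]
    note FNf = F_Arr[OF Nf(1), unfolded Nf(2,3)]
    have fB: "on_arr F f \<in> hom \<B> (on_obj F A) (on_obj F A')" using Ff F_Obj O by (simp add: hom_def)
    then have "on_arr N\<^sub>B (on_arr F f) \<in> hom \<B> (on_obj N\<^sub>B (on_obj F A)) (on_obj N\<^sub>B (on_obj F A'))"
      using functor_NB by (simp add: is_functor_def)
    then have NFf: "on_arr N\<^sub>B (on_arr F f) \<in> Arr X" "Dom X (on_arr N\<^sub>B (on_arr F f)) = on_obj N\<^sub>B (on_obj F A)"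
      "Cod X (on_arr N\<^sub>B (on_arr F f)) = on_obj N\<^sub>B (on_obj F A')" "on_obj N\<^sub>B (on_obj F A) \<in> B"
      by (auto simp: hom_def)
    have al: "\<alpha> D \<in> Arr X" "Dom X (\<alpha> D) = on_obj N\<^sub>B (on_obj F D)" "Cod X (\<alpha> D) = on_obj F (on_obj N\<^sub>X D)"
      if "D \<in> Obj X" for D
      using \<alpha>(1)[OF that] by (simp_all add: hom_def)
    have nb: "\<nu>\<^sub>B (on_obj F D) \<in> Arr X" "Dom X (\<nu>\<^sub>B (on_obj F D)) = on_obj F D"
      "Cod X (\<nu>\<^sub>B (on_obj F D)) = on_obj N\<^sub>B (on_obj F D)" if "D \<in> Obj X" for D
      using nuB[OF F_Obj[OF that]] by simp_all
    have NO: "on_obj N\<^sub>X D \<in> Obj X" if "D \<in> Obj X" for D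
      using Cod_Obj[OF nuX(1)[OF that]] nuX(3)[OF that] by simp
    note T = Ff FNf NFf(1-3) al[OF O(1)] al[OF O(2)] nb[OF O(1)] nb[OF O(2)]
    have natB: "on_arr N\<^sub>B (on_arr F f) \<cdot>\<^bsub>X\<^esub> \<nu>\<^sub>B (on_obj F A) = \<nu>\<^sub>B (on_obj F A') \<cdot>\<^bsub>X\<^esub> on_arr F f"
      using NB(2) fB by (simp add: nat_transf_def id_ftor_def)
    have natX: "on_arr N\<^sub>X f \<cdot>\<^bsub>X\<^esub> \<nu>\<^sub>X A = \<nu>\<^sub>X A' \<cdot>\<^bsub>X\<^esub> f"
      using NX(2) f by (simp add: nat_transf_def id_ftor_def)
    have F_Comp: "on_arr F (g \<cdot>\<^bsub>X\<^esub> h) = on_arr F g \<cdot>\<^bsub>X\<^esub> on_arr F h"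
      if "g \<in> Arr X" "h \<in> Arr X" "Cod X h = Dom X g" for g h
      using refl(1) that by (simp add: is_functor_def)
    have "on_arr F (on_arr N\<^sub>X f) \<cdot>\<^bsub>X\<^esub> \<alpha> A \<cdot>\<^bsub>X\<^esub> \<nu>\<^sub>B (on_obj F A)
        = on_arr F (on_arr N\<^sub>X f) \<cdot>\<^bsub>X\<^esub> (\<alpha> A \<cdot>\<^bsub>X\<^esub> \<nu>\<^sub>B (on_obj F A))"
      by (rule assoc) (use T in simp_all)
    also have "\<dots> = on_arr F (\<nu>\<^sub>X A' \<cdot>\<^bsub>X\<^esub> f)"
      unfolding \<alpha>(2)[OF O(1)] natX[symmetric]
      by (rule F_Comp[symmetric]) (use Nf nuX[OF O(1)] in simp_all)
    also have "\<dots> = on_arr F (\<nu>\<^sub>X A') \<cdot>\<^bsub>X\<^esub> on_arr F f"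
      by (rule F_Comp) (use f' nuX[OF O(2)] in simp_all)
    also have "\<dots> = \<alpha> A' \<cdot>\<^bsub>X\<^esub> (\<nu>\<^sub>B (on_obj F A') \<cdot>\<^bsub>X\<^esub> on_arr F f)"
      unfolding \<alpha>(2)[OF O(2), symmetric] by (rule assoc) (use T in simp_all)
    also have "\<dots> = \<alpha> A' \<cdot>\<^bsub>X\<^esub> on_arr N\<^sub>B (on_arr F f) \<cdot>\<^bsub>X\<^esub> \<nu>\<^sub>B (on_obj F A)"
      unfolding natB[symmetric] by (rule assoc[symmetric]) (use T in simp_all)
    finally have eq: "on_arr F (on_arr N\<^sub>X f) \<cdot>\<^bsub>X\<^esub> \<alpha> A \<cdot>\<^bsub>X\<^esub> \<nu>\<^sub>B (on_obj F A)
        = \<alpha> A' \<cdot>\<^bsub>X\<^esub> on_arr N\<^sub>B (on_arr F f) \<cdot>\<^bsub>X\<^esub> \<nu>\<^sub>B (on_obj F A)" .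
    obtain c where "is_cokernel \<B> c (\<nu>\<^sub>B (on_obj F A))" using coker[OF O(1)] by blast
    from sub.cokernel_cancel[OF this, unfolded full_sub_simps, OF _ _ eq, of "on_obj F (on_obj N\<^sub>X A')"]
    show ?thesis
      using T NFf(4) F_Obj[OF NO[OF O(2)]] by (simp add: hom_def)
  qed
  have "nat_iso X \<B> (N\<^sub>B \<circ>\<^sub>F F) (F \<circ>\<^sub>F N\<^sub>X) \<alpha>"
    unfolding nat_iso_def nat_transf_def
    using is_functor_comp[OF refl(1) functor_NB] is_functor_comp[OF functor_NX refl(1)] \<alpha>(1,3) natural
    by (simp add: comp_ftor_def)
  then show ?thesis using \<alpha>(2) by auto
qed

end
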